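(* With high probability (probability tending to $1$ as $n\to\infty$), the random graph $G_{n,4/n}$ has no graph homomorphism to the $5$-cycle $C_5$.
   Context: $G_{n,p}$ is the Erdős–Rényi random graph on vertex set $\{1,\dots,n\}$ in which each pair of vertices is joined independently with probability $p$. A homomorphism from $G$ to $H$ is a map $f:V(G)\to V(H)$ such that $xy\in E(G)$ implies $f(x)f(y)\in E(H)$. *)

theory Defs
  imports "HOL-Probability.Probability"
begin

(* A simple graph is a pair of a vertex set and a set of edges, the edges being
   two-element sets of vertices. *)
type_synonym 'a graph = "'a set \<times> 'a set set"

abbreviation verts :: "'a graph \<Rightarrow> 'a set" where "verts G \<equiv> fst G"

abbreviation edges :: "'a graph \<Rightarrow> 'a set set" where "edges G \<equiv> snd G"

definition vertex_pairs :: "'a set \<Rightarrow> 'a set set" where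
  "vertex_pairs V = {e. e \<subseteq> V \<and> card e = 2}"

definition graph_hom :: "('a \<Rightarrow> 'b) \<Rightarrow> 'a graph \<Rightarrow> 'b graph \<Rightarrow> bool" where
  "graph_hom f G H \<longleftrightarrow>
     f \<in> verts G \<rightarrow> verts H \<and>
     (\<forall>x y. {x, y} \<in> edges G \<longrightarrow> {f x, f y} \<in> edges H)"

(* A cycle only for k >= 3. *)
definition cycle_graph :: "nat \<Rightarrow> nat graph" where
  "cycle_graph k = ({0..<k}, {{i, (i + 1) mod k} | i. i < k})"

(* bernoulli_pmf clamps p to [0, 1], so p = 4 / n is harmless for the finitely many n < 4. *)
definition random_graph :: "nat \<Rightarrow> real \<Rightarrow> nat graph pmf" where
  "random_graph n p =
     map_pmf (\<lambda>present. ({1..n}, {e \<in> vertex_pairs {1..n}. present e}))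
       (Pi_pmf (vertex_pairs {1..n}) False (\<lambda>_. bernoulli_pmf p))"

end

theory Submission
  imports Defs "HOL-Real_Asymp.Real_Asymp"
begin

text \<open>
  Colour the vertices by the classes 0, ..., 4 of \<open>C\<^sub>5\<close>. A vertex of class \<open>i\<close> without a neighbour
  in class \<open>i + 1\<close> may be moved to class \<open>i - 2\<close>. Along the path 3, 1, 4, 2, 0 such moves cannot go
  on forever, so if a homomorphism exists, then there is one for which every vertex of class
  \<open>i \<noteq> 0\<close> has a neighbour in class \<open>i + 1\<close>; choosing first the number of vertices of class 3 as small
  as possible also makes class 3 the smallest one, by rotating the colours. The conditions involve
  disjoint sets of edges, so the expected number of such colourings with \<open>a\<^sub>i n\<close> vertices of
  class \<open>i\<close> is, up to polynomial factors, at most \<open>exp (n F(a))\<close> where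
  \<open>F(a) = - 2 + (\<Sum>i. 4 a\<^sub>i a\<^sub>i\<^sub>+\<^sub>1 - a\<^sub>i ln a\<^sub>i) + (\<Sum>i\<noteq>0. a\<^sub>i ln (1 - exp (- 4 a\<^sub>i\<^sub>+\<^sub>1)))\<close>.
  On the simplex restricted to \<open>a\<^sub>3 = min a\<close> the maximum of \<open>F\<close> is about \<open>- 0.0256\<close>. That it is negative
  is shown by cutting the region into boxes; on each box the logarithms are replaced by tangents,
  and the resulting quadratic form is bounded.
\<close>

section \<open>Tight colourings\<close>

datatype colour = C0 | C1 | C2 | C3 | C4

lemma UNIV_colour: "UNIV = {C0, C1, C2, C3, C4}"
  using colour.exhaust by auto

instance colour :: finite
  by standard (simp add: UNIV_colour)

lemma sum_colour: "(\<Sum>i\<in>UNIV. f i) = f C0 + f C1 + f C2 + f C3 + f C4"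
  for f :: "colour \<Rightarrow> 'a::comm_monoid_add"
  by (simp add: UNIV_colour add.assoc)

primrec nxt :: "colour \<Rightarrow> colour" where
  "nxt C0 = C1" | "nxt C1 = C2" | "nxt C2 = C3" | "nxt C3 = C4" | "nxt C4 = C0"


definition adj :: "colour \<Rightarrow> colour \<Rightarrow> bool" where
  "adj i j \<longleftrightarrow> j = nxt i \<or> i = nxt j"

lemma inj_nxt: "inj nxt"
proof (rule injI)
  fix i j show "nxt i = nxt j \<Longrightarrow> i = j" by (cases i; cases j) simp_all
qed

lemma adj_nxt: "adj (nxt i) (nxt j) \<longleftrightarrow> adj i j"
  using inj_nxt by (simp add: adj_def inj_eq)

definition proper :: "'a set \<Rightarrow> 'a set set \<Rightarrow> ('a \<Rightarrow> colour) \<Rightarrow> bool" where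
  "proper V E h \<longleftrightarrow> (\<forall>x\<in>V. \<forall>y\<in>V. {x, y} \<in> E \<longrightarrow> adj (h x) (h y))"

definition col_class :: "'a set \<Rightarrow> ('a \<Rightarrow> colour) \<Rightarrow> colour \<Rightarrow> 'a set" where
  "col_class V h i = {v \<in> V. h v = i}"

lemma finite_col_class [simp]: "finite V \<Longrightarrow> finite (col_class V h i)"
  by (simp add: col_class_def)

lemma sum_col_class:
  fixes f :: "colour \<Rightarrow> 'b::comm_semiring_1"
  assumes "finite V"
  shows "(\<Sum>v\<in>V. f (h v)) = (\<Sum>i\<in>UNIV. of_nat (card (col_class V h i)) * f i)"
proof -
  have "(\<Sum>v\<in>V. f (h v)) = (\<Sum>i\<in>UNIV. \<Sum>v\<in>{v \<in> V. h v = i}. f (h v))"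
    using assms by (intro sum.group[symmetric]) auto
  also have "\<dots> = (\<Sum>i\<in>UNIV. \<Sum>v\<in>{v \<in> V. h v = i}. f i)"
    by (intro sum.cong) auto
  finally show ?thesis by (simp add: col_class_def)
qed

lemma prod_col_class:
  fixes f :: "colour \<Rightarrow> 'b::comm_semiring_1"
  assumes "finite V"
  shows "(\<Prod>v\<in>V. f (h v)) = (\<Prod>i\<in>UNIV. f i ^ card (col_class V h i))"
proof -
  have "(\<Prod>v\<in>V. f (h v)) = (\<Prod>i\<in>UNIV. \<Prod>v\<in>{v \<in> V. h v = i}. f (h v))"
    using assms by (intro prod.group[symmetric]) auto
  also have "\<dots> = (\<Prod>i\<in>UNIV. \<Prod>v\<in>{v \<in> V. h v = i}. f i)"
    by (intro prod.cong) auto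
  finally show ?thesis by (simp add: col_class_def)
qed

lemma sum_card_col_class: "finite V \<Longrightarrow> (\<Sum>i\<in>UNIV. card (col_class V h i)) = card V"
  using sum_col_class[of V "\<lambda>_. 1::nat" h] by simp

lemma proper_rotate:
  assumes "proper V E h"
  shows "proper V E (restrict ((nxt ^^ k) \<circ> h) V)"
proof -
  have "adj ((nxt ^^ k) i) ((nxt ^^ k) j) \<longleftrightarrow> adj i j" for i j
    by (induction k) (simp_all add: adj_nxt)
  then show ?thesis using assms by (simp add: proper_def)
qed

text \<open>With i the colour of \<open>v\<close>, properness and the missing neighbour leave only
  colour i - 1 for the neighbours of \<open>v\<close>. That colour is adjacent to i - 2 as well as
  to i, and three steps forward are two steps back.\<close>

lemma proper_shift:
  assumes h: "proper V E h" and E: "E \<subseteq> vertex_pairs V" and v: "v \<in> V"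
    and no: "\<not> (\<exists>u\<in>V. {v, u} \<in> E \<and> h u = nxt (h v))"
  shows "proper V E (h(v := (nxt ^^ 3) (h v)))"
  unfolding proper_def
proof (intro ballI impI)
  fix x y assume xy: "x \<in> V" "y \<in> V" "{x, y} \<in> E"
  have ne: "x \<noteq> y" using xy(3) E by (auto simp: vertex_pairs_def)
  have key: "adj ((nxt ^^ 3) (h v)) (h u)" "adj (h u) ((nxt ^^ 3) (h v))" if "u \<in> V" "{v, u} \<in> E" for u
  proof -
    have "adj (h v) (h u)" "h u \<noteq> nxt (h v)" using h that v no by (auto simp: proper_def)
    then have "h v = nxt (h u)" by (auto simp: adj_def)
    then have "(nxt ^^ 4) (h u) = (nxt ^^ 3) (h v)" by (simp add: eval_nat_numeral)
    moreover have "nxt ((nxt ^^ 4) (h u)) = h u" by (cases "h u") (simp_all add: eval_nat_numeral)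
    ultimately show "adj ((nxt ^^ 3) (h v)) (h u)" "adj (h u) ((nxt ^^ 3) (h v))"
      by (auto simp: adj_def)
  qed
  show "adj ((h(v := (nxt ^^ 3) (h v))) x) ((h(v := (nxt ^^ 3) (h v))) y)"
    using key[of x] key[of y] xy ne h by (auto simp: proper_def insert_commute)
qed

text \<open>Take a proper colouring of least \<open>cost\<close>. A vertex without the required
  neighbour could be shifted to a colour of lower rank, and a class smaller than class
  \<open>C3\<close> could be rotated onto it; either change would lower the cost.\<close>

lemma exists_tight_colouring:
  assumes fin: "finite V" and E: "E \<subseteq> vertex_pairs V" and h0: "proper V E h0"
  shows "\<exists>h \<in> V \<rightarrow>\<^sub>E UNIV. proper V E h
    \<and> (\<forall>v\<in>V. h v \<noteq> C0 \<longrightarrow> (\<exists>u\<in>V. {v, u} \<in> E \<and> h u = nxt (h v)))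
    \<and> (\<forall>i. card (col_class V h C3) \<le> card (col_class V h i))"
proof -
  \<comment> \<open>All other ranks together contribute at most 3 card V, which is below
    \<open>R\<close>, so costs compare first by the size of class \<open>C3\<close>.
    \<open>R\<close> also exceeds 3, the rank of the colour \<open>C1\<close> to which
    \<open>C3\<close> is shifted.\<close>
  define R where "R = 3 * card V + 4"
  \<comment> \<open>A shift by 3 = - 2 lowers the rank of every colour but \<open>C0\<close>.\<close>
  define rank where "rank i = (case i of C0 \<Rightarrow> 0 | C2 \<Rightarrow> 1 | C4 \<Rightarrow> 2 | C1 \<Rightarrow> 3 | C3 \<Rightarrow> R)" for i
  define cost where "cost h = (\<Sum>v\<in>V. rank (h v))" for h
  define P where "P h \<longleftrightarrow> h \<in> V \<rightarrow>\<^sub>E UNIV \<and> proper V E h" for h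
  have "P (restrict h0 V)" using h0 by (simp add: P_def proper_def)
  then obtain h where h: "P h" and least: "\<And>h'. P h' \<Longrightarrow> cost h \<le> cost h'"
    using ex_has_least_nat[of P _ cost] by blast
  have tight: "\<exists>u\<in>V. {v, u} \<in> E \<and> h u = nxt (h v)" if v: "v \<in> V" "h v \<noteq> C0" for v
  proof (rule ccontr)
    assume no: "\<not> ?thesis"
    define h' where "h' = h(v := (nxt ^^ 3) (h v))"
    have "P h'" using h proper_shift[OF _ E v(1) no] v(1)
      by (auto simp: P_def h'_def PiE_def extensional_def)
    moreover have "cost h' < cost h"
    proof -
      have "rank ((nxt ^^ 3) (h v)) < rank (h v)"
        using v(2) by (cases "h v") (simp_all add: rank_def eval_nat_numeral R_def)
      then show ?thesis
        unfolding cost_def using fin v(1) by (intro sum_strict_mono_ex1) (auto simp: h'_def)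
    qed
    ultimately show False using least[of h'] by simp
  qed
  have cost_bounds: "R * card (col_class V g C3) \<le> cost g"
    "cost g \<le> R * card (col_class V g C3) + 3 * card V" for g
  proof -
    have eq: "R * card (col_class V g C3) = (\<Sum>v\<in>V. if g v = C3 then R else 0)"
      using fin by (simp add: col_class_def sum.If_cases Int_def conj_commute)
    show "R * card (col_class V g C3) \<le> cost g"
      unfolding eq cost_def by (intro sum_mono) (auto simp: rank_def)
    have "cost g \<le> (\<Sum>v\<in>V. (if g v = C3 then R else 0) + 3)"
      unfolding cost_def by (intro sum_mono) (auto simp: rank_def split: colour.split)
    then show "cost g \<le> R * card (col_class V g C3) + 3 * card V"
      unfolding eq by (simp add: sum.distrib)
  qed
  have "card (col_class V h C3) \<le> card (col_class V h i)" for i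
  proof (rule ccontr)
    assume less: "\<not> ?thesis"
    \<comment> \<open>The exponent is the number of forward steps from i to 3 modulo 5.\<close>
    have "(nxt ^^ (case i of C0 \<Rightarrow> 3 | C1 \<Rightarrow> 2 | C2 \<Rightarrow> 1 | C3 \<Rightarrow> 0 | C4 \<Rightarrow> 4)) i = C3"
      by (cases i) (simp_all add: eval_nat_numeral)
    then obtain k where k: "(nxt ^^ k) i = C3" ..
    have inj: "inj (nxt ^^ k)" by (rule inj_fn[OF inj_nxt])
    define h' where "h' = restrict ((nxt ^^ k) \<circ> h) V"
    have Ph': "P h'" using h proper_rotate[of V E h k] by (simp add: P_def h'_def)
    have "col_class V h' C3 = col_class V h i"
      using inj by (auto simp: col_class_def h'_def k[symmetric] inj_eq)
    then have "cost h' \<le> R * card (col_class V h i) + 3 * card V"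
      using cost_bounds(2)[of h'] by simp
    then have "cost h' < R * (card (col_class V h i) + 1)" by (simp add: R_def)
    also have "\<dots> \<le> R * card (col_class V h C3)" using less by (intro mult_left_mono) auto
    also have "\<dots> \<le> cost h" by (rule cost_bounds)
    finally show False using least[OF Ph'] by simp
  qed
  then show ?thesis using h tight by (auto simp: P_def)
qed

lemma graph_hom_cycle_graph_5_imp_proper:
  assumes hom: "graph_hom f (V, E) (cycle_graph 5)"
  shows "\<exists>h. proper V E h"
proof -
  \<comment> \<open>Values above 4 also fall to \<open>C4\<close>, but they are never endpoints of
    an edge of the cycle.\<close>
  define col where "col k = (if k = 0 then C0 else if k = 1 then C1 else if k = 2 then C2
    else if k = 3 then C3 else C4)" for k :: nat
  have mod5: "col (Suc i mod 5) = nxt (col i)" if "i < 5" for i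
  proof -
    have "i \<in> {0, 1, 2, 3, 4}" using that by auto
    then show ?thesis by (auto simp: col_def)
  qed
  have "proper V E (col \<circ> f)"
    unfolding proper_def
  proof (intro ballI impI)
    fix x y assume "x \<in> V" "y \<in> V" "{x, y} \<in> E"
    then have "{f x, f y} \<in> edges (cycle_graph 5)" using hom by (auto simp: graph_hom_def)
    then obtain i where i: "{f x, f y} = {i, Suc i mod 5}" "i < 5" by (auto simp: cycle_graph_def)
    then have "f x = i \<and> f y = Suc i mod 5 \<or> f y = i \<and> f x = Suc i mod 5" by (auto simp: doubleton_eq_iff)
    then show "adj ((col \<circ> f) x) ((col \<circ> f) y)" using mod5[OF i(2)] by (auto simp: adj_def)
  qed
  then show ?thesis by blast
qed

section \<open>Quadratic bounds\<close>

text \<open>Write |x_i| = t_i w_i with t_i in [0, 1] and use t_i t_j <= (t_i^2 + t_j^2) / 2 off the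
  diagonal. This gives a linear function of the t_i^2 whose coefficients are weighted row sums.
  Diagonal entries keep their sign, so negative ones offset the others; \<open>max 0\<close>
  accounts for small t_i.\<close>

lemma quadratic_form_le_on_box:
  fixes N :: "'i::finite \<Rightarrow> 'i \<Rightarrow> real"
  assumes sym: "\<And>i j. N i j = N j i" and x: "\<And>i. \<bar>x i\<bar> \<le> w i"
  shows "(\<Sum>i\<in>UNIV. \<Sum>j\<in>UNIV. N i j * x i * x j)
    \<le> (\<Sum>i\<in>UNIV. w i * max 0 (\<Sum>j\<in>UNIV. (if i = j then N i j else \<bar>N i j\<bar>) * w j))"
proof -
  define M where "M i j = (if i = j then N i j else \<bar>N i j\<bar>)" for i j
  \<comment> \<open>If \<open>w i\<close> is 0, then so is \<open>x i\<close>, and the value 0 still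
    satisfies |x_i| = t_i w_i.\<close>
  define t where "t i = (if w i = 0 then 0 else \<bar>x i\<bar> / w i)" for i
  have w0: "0 \<le> w i" for i using x[of i] by linarith
  have t: "\<bar>x i\<bar> = t i * w i" "0 \<le> t i" "t i \<le> 1" for i
    using x[of i] w0[of i] by (auto simp: t_def)
  have Msym: "M i j = M j i" for i j using sym by (simp add: M_def)
  have "N i j * x i * x j \<le> M i j * w i * w j * ((t i)\<^sup>2 + (t j)\<^sup>2) / 2" for i j
  proof (cases "i = j")
    case True
    have "x i * x i = \<bar>x i\<bar> * \<bar>x i\<bar>" by simp
    also have "\<dots> = t i * w i * (t i * w i)" by (simp only: t(1))
    finally have sq: "x i * x i = t i * w i * (t i * w i)" .
    have "N i j * x i * x j = N i i * (x i * x i)" using True by simp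
    also have "\<dots> = M i j * w i * w j * ((t i)\<^sup>2 + (t j)\<^sup>2) / 2"
      unfolding sq using True by (simp add: M_def power2_eq_square)
    finally show ?thesis by simp
  next
    case False
    have "N i j * x i * x j \<le> \<bar>N i j\<bar> * (\<bar>x i\<bar> * \<bar>x j\<bar>)"
      by (metis abs_ge_self abs_mult mult.assoc)
    also have "\<dots> = \<bar>N i j\<bar> * w i * w j * (t i * t j)" by (simp add: t(1))
    also have "\<dots> \<le> \<bar>N i j\<bar> * w i * w j * (((t i)\<^sup>2 + (t j)\<^sup>2) / 2)"
      using sum_squares_bound[of "t i" "t j"] w0 by (intro mult_left_mono) auto
    finally show ?thesis using False by (simp add: M_def)
  qed
  then have "(\<Sum>i\<in>UNIV. \<Sum>j\<in>UNIV. N i j * x i * x j)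
      \<le> (\<Sum>i\<in>UNIV. \<Sum>j\<in>UNIV. M i j * w i * w j * ((t i)\<^sup>2 + (t j)\<^sup>2) / 2)"
    by (intro sum_mono)
  also have "\<dots> = (\<Sum>i\<in>UNIV. \<Sum>j\<in>UNIV. M i j * w i * w j * (t i)\<^sup>2 / 2)
      + (\<Sum>i\<in>UNIV. \<Sum>j\<in>UNIV. M i j * w i * w j * (t j)\<^sup>2 / 2)"
    by (simp add: sum.distrib[symmetric] algebra_simps add_divide_distrib)
  also have "(\<Sum>i\<in>UNIV. \<Sum>j\<in>UNIV. M i j * w i * w j * (t j)\<^sup>2 / 2)
      = (\<Sum>i\<in>UNIV. \<Sum>j\<in>UNIV. M i j * w i * w j * (t i)\<^sup>2 / 2)"
    by (subst sum.swap) (simp add: Msym mult.assoc mult.left_commute)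
  also have "(\<Sum>i\<in>UNIV. \<Sum>j\<in>UNIV. M i j * w i * w j * (t i)\<^sup>2 / 2)
      + (\<Sum>i\<in>UNIV. \<Sum>j\<in>UNIV. M i j * w i * w j * (t i)\<^sup>2 / 2)
      = (\<Sum>i\<in>UNIV. (t i)\<^sup>2 * (w i * (\<Sum>j\<in>UNIV. M i j * w j)))"
    by (simp add: sum.distrib[symmetric] sum_distrib_left algebra_simps)
  also have "\<dots> \<le> (\<Sum>i\<in>UNIV. w i * max 0 (\<Sum>j\<in>UNIV. M i j * w j))"
  proof (intro sum_mono)
    fix i
    have "(t i)\<^sup>2 * (w i * (\<Sum>j\<in>UNIV. M i j * w j)) \<le> (t i)\<^sup>2 * (w i * max 0 (\<Sum>j\<in>UNIV. M i j * w j))"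
      using w0[of i] by (intro mult_left_mono) auto
    also have "\<dots> \<le> 1 * (w i * max 0 (\<Sum>j\<in>UNIV. M i j * w j))"
      using w0[of i] t[of i] by (intro mult_right_mono) (auto simp: power_le_one)
    finally show "(t i)\<^sup>2 * (w i * (\<Sum>j\<in>UNIV. M i j * w j)) \<le> w i * max 0 (\<Sum>j\<in>UNIV. M i j * w j)"
      by simp
  qed
  finally show ?thesis by (simp add: M_def)
qed

text \<open>Taylor expansion at the centre c, with g half the gradient there. The deviations a_i -
  c_i have the known sum 1 - \<Sum>c, so any constant \<nu> may be subtracted from all g_i before
  the linear term is bounded by absolute values.\<close>

lemma quadratic_le_on_slice:
  fixes N :: "'i::finite \<Rightarrow> 'i \<Rightarrow> real"
  assumes sym: "\<And>i j. N i j = N j i" and w: "\<And>i. \<bar>a i - c i\<bar> \<le> w i"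
    and sum1: "(\<Sum>i\<in>UNIV. a i) = 1"
    and g: "\<And>i. g i = L i + (\<Sum>j\<in>UNIV. N i j * c j)"
  shows "2 * (\<Sum>i\<in>UNIV. L i * a i) + (\<Sum>i\<in>UNIV. \<Sum>j\<in>UNIV. N i j * a i * a j)
    \<le> (\<Sum>i\<in>UNIV. c i * (L i + g i)) + 2 * \<nu> * (1 - (\<Sum>i\<in>UNIV. c i))
      + 2 * (\<Sum>i\<in>UNIV. w i * \<bar>g i - \<nu>\<bar>)
      + (\<Sum>i\<in>UNIV. w i * max 0 (\<Sum>j\<in>UNIV. (if i = j then N i j else \<bar>N i j\<bar>) * w j))"
proof -
  define x where "x i = a i - c i" for i
  have a: "a i = c i + x i" for i by (simp add: x_def)
  have swap: "(\<Sum>i\<in>UNIV. \<Sum>j\<in>UNIV. N i j * c i * x j) = (\<Sum>i\<in>UNIV. \<Sum>j\<in>UNIV. N i j * x i * c j)"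
    by (subst sum.swap) (simp add: sym mult.assoc mult.left_commute mult.commute)
  have "2 * (\<Sum>i\<in>UNIV. L i * a i) + (\<Sum>i\<in>UNIV. \<Sum>j\<in>UNIV. N i j * a i * a j)
      = 2 * (\<Sum>i\<in>UNIV. L i * c i) + 2 * (\<Sum>i\<in>UNIV. L i * x i)
        + (\<Sum>i\<in>UNIV. \<Sum>j\<in>UNIV. N i j * c i * c j) + (\<Sum>i\<in>UNIV. \<Sum>j\<in>UNIV. N i j * c i * x j)
        + (\<Sum>i\<in>UNIV. \<Sum>j\<in>UNIV. N i j * x i * c j) + (\<Sum>i\<in>UNIV. \<Sum>j\<in>UNIV. N i j * x i * x j)"
    by (simp add: a algebra_simps sum.distrib)
  also have "\<dots> = (\<Sum>i\<in>UNIV. c i * (L i + g i)) + 2 * (\<Sum>i\<in>UNIV. g i * x i)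
        + (\<Sum>i\<in>UNIV. \<Sum>j\<in>UNIV. N i j * x i * x j)"
    unfolding swap by (simp add: g algebra_simps sum.distrib sum_distrib_left sum_distrib_right)
  also have "(\<Sum>i\<in>UNIV. g i * x i) = (\<Sum>i\<in>UNIV. (g i - \<nu>) * x i) + \<nu> * (\<Sum>i\<in>UNIV. x i)"
    by (simp add: algebra_simps sum_subtractf sum_distrib_left)
  also have "(\<Sum>i\<in>UNIV. x i) = 1 - (\<Sum>i\<in>UNIV. c i)"
    using sum1 by (simp add: x_def sum_subtractf)
  finally have eq: "2 * (\<Sum>i\<in>UNIV. L i * a i) + (\<Sum>i\<in>UNIV. \<Sum>j\<in>UNIV. N i j * a i * a j)
      = (\<Sum>i\<in>UNIV. c i * (L i + g i))
        + 2 * ((\<Sum>i\<in>UNIV. (g i - \<nu>) * x i) + \<nu> * (1 - (\<Sum>i\<in>UNIV. c i)))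
        + (\<Sum>i\<in>UNIV. \<Sum>j\<in>UNIV. N i j * x i * x j)" .
  have "(g i - \<nu>) * x i \<le> w i * \<bar>g i - \<nu>\<bar>" for i
  proof -
    have "(g i - \<nu>) * x i \<le> \<bar>g i - \<nu>\<bar> * \<bar>x i\<bar>" by (metis abs_ge_self abs_mult)
    also have "\<dots> \<le> \<bar>g i - \<nu>\<bar> * w i" using w[of i] by (intro mult_left_mono) (auto simp: x_def)
    finally show ?thesis by (simp add: mult.commute)
  qed
  then have "(\<Sum>i\<in>UNIV. (g i - \<nu>) * x i) \<le> (\<Sum>i\<in>UNIV. w i * \<bar>g i - \<nu>\<bar>)"
    by (intro sum_mono)
  moreover have "(\<Sum>i\<in>UNIV. \<Sum>j\<in>UNIV. N i j * x i * x j)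
    \<le> (\<Sum>i\<in>UNIV. w i * max 0 (\<Sum>j\<in>UNIV. (if i = j then N i j else \<bar>N i j\<bar>) * w j))"
    using w by (intro quadratic_form_le_on_box sym) (simp add: x_def)
  ultimately show ?thesis unfolding eq by (simp add: algebra_simps)
qed

text \<open>On the positive numbers up to max u p, the second derivative 1 / x of x ln x is at least
  2 d, so x ln x - d x^2 is convex there and lies above its tangent at p. \<open>T\<close> is the
  slope at p of - x ln x rounded up, harmless since a >= 0.\<close>

lemma neg_mult_ln_le_quadratic:
  fixes a p u d T :: real
  assumes "0 \<le> a" "a \<le> u" "0 < p" "0 \<le> d" "2 * d * u \<le> 1" "2 * d * p \<le> 1" "- ln p - 1 \<le> T"
  shows "- a * ln a \<le> a * T + p - d * (a - p)\<^sup>2"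
proof -
  \<comment> \<open>The gap between the two sides with the exact slope - ln p - 1 in place of
    \<open>T\<close>; it vanishes together with its derivative at p.\<close>
  define h where "h x = x * ln x - x - x * ln p + p - d * (x - p)\<^sup>2" for x
  have h': "(h has_real_derivative (ln x - ln p - 2 * d * (x - p))) (at x)" if "0 < x" for x
    unfolding h_def using that by (auto intro!: derivative_eq_intros simp: power2_eq_square algebra_simps)
  have "0 \<le> h a"
  \<comment> \<open>The derivative is available only for positive arguments; at 0 the term 0 * ln 0
    is 0, which leaves p - d p^2 >= p / 2.\<close>
  proof (cases "a = 0")
    case True
    have "d * p\<^sup>2 \<le> p / 2"
      using assms mult_right_mono[of "2 * d * p" 1 p] by (simp add: power2_eq_square)
    then show ?thesis using True assms(3) by (simp add: h_def)
  next
    case False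
    then have a0: "0 < a" using assms by simp
    have d: "2 * d * x \<le> 1" if "x \<le> max a p" for x
    proof -
      have "2 * d * x \<le> 2 * d * max a p" using that assms(4) by (intro mult_left_mono) auto
      also have "\<dots> \<le> 1" using assms mult_left_mono[of a u "2 * d"] by (auto simp: max_def)
      finally show ?thesis .
    qed
    have ln_ge: "2 * d * (y - x) \<le> ln y - ln x" if "0 < x" "x \<le> y" "y \<le> max a p" for x y
    proof -
      have "2 * d * (y - x) * y \<le> (y - x) * 1"
        using d[OF that(3)] that mult_left_mono[of "2 * d * y" 1 "y - x"] by (simp add: algebra_simps)
      then have "2 * d * (y - x) \<le> (y - x) / y" using that by (simp add: field_simps)
      also have "\<dots> = 1 - x / y" using that by (simp add: field_simps)
      also have "\<dots> \<le> - ln (x / y)" using that ln_le_minus_one[of "x / y"] by simp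
      also have "\<dots> = ln y - ln x" using that by (simp add: ln_div)
      finally show ?thesis .
    qed
    have hp: "h p = 0" by (simp add: h_def)
    show ?thesis
    proof (cases "a \<le> p")
      case True
      have "h p \<le> h a"
      proof (rule DERIV_nonpos_imp_nonincreasing[of a p h, OF True])
        fix x assume "a \<le> x" "x \<le> p"
        then show "\<exists>y. DERIV h x :> y \<and> y \<le> 0"
          using h'[of x] ln_ge[of x p] a0 by (intro exI[of _ "ln x - ln p - 2 * d * (x - p)"]) (auto simp: algebra_simps)
      qed
      then show ?thesis using hp by simp
    next
      case False
      have "h p \<le> h a"
      proof (rule DERIV_nonneg_imp_nondecreasing[of p a h])
        show "p \<le> a" using False by simp
        fix x assume "p \<le> x" "x \<le> a"
        then show "\<exists>y. DERIV h x :> y \<and> 0 \<le> y"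
          using h'[of x] ln_ge[of p x] assms(3) by (intro exI[of _ "ln x - ln p - 2 * d * (x - p)"]) (auto simp: algebra_simps)
      qed
      then show ?thesis using hp by simp
    qed
  qed
  moreover have "a * (- ln p - 1) \<le> a * T" using assms by (intro mult_left_mono) auto
  ultimately show ?thesis by (simp add: h_def algebra_simps)
qed

text \<open>This is the tangent of slope s to a concave function. With y = 1 - exp (- x), it says
  that ln y + s ln (1 - y) is largest at y = 1 / (1 + s). Apply ln z <= z - 1 to the ratios of y and
  1 - y to their values there, with weights 1 and s; the right-hand sides cancel.\<close>

lemma ln_one_minus_exp_le:
  fixes x s :: real
  assumes "0 < x" "0 < s"
  shows "ln (1 - exp (- x)) \<le> s * x + (ln (1 / (1 + s)) + s * ln (s / (1 + s)))"
proof -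
  define y where "y = 1 - exp (- x)"
  have y: "0 < y" "y < 1" using assms by (auto simp: y_def)
  have 1: "ln (y * (1 + s)) \<le> y * (1 + s) - 1"
    using y assms by (intro ln_le_minus_one) auto
  have "ln ((1 - y) * (1 + s) / s) \<le> (1 - y) * (1 + s) / s - 1"
    using y assms by (intro ln_le_minus_one) auto
  then have "s * ln ((1 - y) * (1 + s) / s) \<le> s * ((1 - y) * (1 + s) / s - 1)"
    using assms by (intro mult_left_mono) auto
  then have 2: "s * ln ((1 - y) * (1 + s) / s) \<le> (1 - y) * (1 + s) - s"
    using assms by (simp add: right_diff_distrib)
  have 3: "ln (y * (1 + s)) = ln y - ln (1 / (1 + s))"
    using y assms by (simp add: ln_mult ln_div)
  have 4: "ln ((1 - y) * (1 + s) / s) = - x - ln (s / (1 + s))"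
    using y assms by (simp add: ln_mult ln_div y_def)
  have "s * (- x - ln (s / (1 + s))) = - (s * x) - s * ln (s / (1 + s))"
    by (simp add: algebra_simps)
  moreover have "y * (1 + s) - 1 + ((1 - y) * (1 + s) - s) = 0"
    by (simp add: algebra_simps)
  ultimately have "ln y \<le> s * x + (ln (1 / (1 + s)) + s * ln (s / (1 + s)))"
    using 1 2 unfolding 3 4 by linarith
  then show ?thesis by (simp add: y_def)
qed

section \<open>The exponent is negative\<close>

datatype vec = Vec int int int int int

primrec entry :: "vec \<Rightarrow> colour \<Rightarrow> int" where
  "entry (Vec a b c d e) i = (case i of C0 \<Rightarrow> a | C1 \<Rightarrow> b | C2 \<Rightarrow> c | C3 \<Rightarrow> d | C4 \<Rightarrow> e)"

text \<open>Functions of a colour are stored as explicit five-entry data, so that the certificate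
  can be evaluated by \<open>code_simp\<close>.\<close>

definition tab :: "(colour \<Rightarrow> int) \<Rightarrow> vec" where
  "tab f = Vec (f C0) (f C1) (f C2) (f C3) (f C4)"

definition upd :: "vec \<Rightarrow> colour \<Rightarrow> int \<Rightarrow> vec" where
  "upd x i r = tab (\<lambda>j. if j = i then r else entry x j)"

definition total :: "(colour \<Rightarrow> int) \<Rightarrow> int" where
  "total f = f C0 + f C1 + f C2 + f C3 + f C4"

definition each :: "(colour \<Rightarrow> bool) \<Rightarrow> bool" where
  "each P \<longleftrightarrow> P C0 \<and> P C1 \<and> P C2 \<and> P C3 \<and> P C4"

lemma entry_tab [simp]: "entry (tab f) i = f i"
  by (cases i) (simp_all add: tab_def)

lemma entry_upd: "entry (upd x i r) j = (if j = i then r else entry x j)"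
  by (simp add: upd_def)

lemma total_eq: "total f = (\<Sum>i\<in>UNIV. f i)"
  by (simp add: total_def sum_colour)

lemma each_iff: "each P \<longleftrightarrow> (\<forall>i. P i)"
  unfolding each_def by (metis colour.exhaust)

text \<open>
  An entry \<open>(P, T)\<close> gives the tangent of \<open>- a ln a\<close> at \<open>P / 512\<close>, with slope \<open>T / 2048\<close>. An entry
  \<open>(s, B)\<close> of the second table gives the tangent of \<open>ln (1 - exp (- 4 a))\<close> with slope \<open>s / 4\<close>, with
  intercept \<open>B / 2048\<close>. The numbers \<open>P\<close>, \<open>s\<close>, \<open>s + 16\<close> have no prime factors but 2 and 3, so that
  bounds for \<open>ln 2\<close> and \<open>ln 3\<close> suffice.
\<close>

definition entropy_table :: "(int \<times> int) list" where
  "entropy_table = [(4, 7890), (6, 7059), (9, 6229), (12, 5640), (16, 5050), (18, 4809), (24, 4220), (27, 3979), (32, 3631), (36, 3390), (48, 2800), (54, 2559), (64, 2211), (72, 1970), (81, 1729), (96, 1381), (108, 1140), (128, 792), (144, 550), (162, 309), (192, (-39)), (216, (-280)), (256, (-628)), (288, (-869)), (324, (-1110)), (384, (-1458)), (432, (-1699))]"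

definition cover_table :: "(int \<times> int) list" where
  "cover_table = [(2, (-803)), (8, (-1955)), (16, (-2839)), (32, (-3910)), (48, (-4606)), (128, (-6429))]"

section \<open>Verification of the tangent tables\<close>

lemma ln_2_bounds: "ln 2 \<in> {693147/1000000..693148/1000000::real}"
  using ln_approx_bounds[of 2 6] by (simp add: eval_nat_numeral)

lemma ln_3_bounds: "ln 3 \<in> {1098612/1000000..1098613/1000000::real}"
  using ln_approx_bounds[of 3 10] by (simp add: eval_nat_numeral)

lemma ln_smooth: "ln (2 ^ a * 3 ^ b :: real) = real a * ln 2 + real b * ln 3"
  by (simp add: ln_mult ln_realpow)


definition entropy_exponents :: "(nat \<times> nat \<times> int) list" where
  "entropy_exponents = [
    (2, 0, 7890), (1, 1, 7059), (0, 2, 6229), (2, 1, 5640), (4, 0, 5050), (1, 2, 4809),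
    (3, 1, 4220), (0, 3, 3979), (5, 0, 3631), (2, 2, 3390), (4, 1, 2800), (1, 3, 2559),
    (6, 0, 2211), (3, 2, 1970), (0, 4, 1729), (5, 1, 1381), (2, 3, 1140), (7, 0, 792),
    (4, 2, 550), (1, 4, 309), (6, 1, (-39)), (3, 3, (-280)), (8, 0, (-628)), (5, 2, (-869)),
    (2, 4, (-1110)), (7, 1, (-1458)), (4, 3, (-1699))]"

lemma entropy_table_smooth:
  "entropy_table = map (\<lambda>(a, b, T). (2 ^ a * 3 ^ b, T)) entropy_exponents"
  by (simp add: entropy_table_def entropy_exponents_def)

text \<open>With P = 2^a 3^b and 512 = 2^9, each entry becomes a linear inequality in ln 2 and ln 3,
  which the decimal bounds decide.\<close>

lemma entropy_tableD:
  assumes "(P, T) \<in> set entropy_table"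
  shows "0 < P" "- ln (real_of_int P / 512) - 1 \<le> real_of_int T / 2048"
proof -
  obtain a b where P: "P = 2 ^ a * 3 ^ b" and mem: "(a, b, T) \<in> set entropy_exponents"
    using assms unfolding entropy_table_smooth by auto
  have le: "(9 - real a) * ln 2 - real b * ln 3 - 1 \<le> real_of_int T / 2048"
    using mem ln_2_bounds ln_3_bounds by (auto simp: entropy_exponents_def)
  show "0 < P" by (simp add: P)
  have "ln (512::real) = 9 * ln 2"
    using ln_smooth[of 9 0] by simp
  then show "- ln (real_of_int P / 512) - 1 \<le> real_of_int T / 2048"
    using le ln_smooth[of a b] by (simp add: P ln_div algebra_simps)
qed

text \<open>The first two exponents factor s, the next two s + 16: for slope s / 16 the intercept of
  the tangent involves ln (16 / (s + 16)) and ln (s / (s + 16)).\<close>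

definition cover_exponents :: "(nat \<times> nat \<times> nat \<times> nat \<times> int) list" where
  "cover_exponents = [
    (1, 0, 1, 2, (-803)), (3, 0, 3, 1, (-1955)), (4, 0, 5, 0, (-2839)), (5, 0, 4, 1, (-3910)),
    (4, 1, 6, 0, (-4606)), (7, 0, 4, 2, (-6429))]"

lemma cover_table_smooth:
  "cover_table = map (\<lambda>(a, b, a', b', B). (2 ^ a * 3 ^ b, B)) cover_exponents"
  by (simp add: cover_table_def cover_exponents_def)

lemma cover_tableD:
  assumes "(s, B) \<in> set cover_table"
  shows "0 < s" "s \<le> 128"
    "ln (1 / (1 + real_of_int s / 16)) + real_of_int s / 16 * ln (real_of_int s / 16 / (1 + real_of_int s / 16))
      \<le> real_of_int B / 2048"
proof -
  obtain a b a' b' where s: "s = 2 ^ a * 3 ^ b" and mem: "(a, b, a', b', B) \<in> set cover_exponents"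
    using assms unfolding cover_table_smooth by auto
  have s16: "(2::int) ^ a * 3 ^ b + 16 = 2 ^ a' * 3 ^ b'" "(2::int) ^ a * 3 ^ b \<le> 128"
    using mem by (auto simp: cover_exponents_def)
  have le: "4 * ln 2 - (real a' * ln 2 + real b' * ln 3)
      + 2 ^ a * 3 ^ b / 16 * ((real a * ln 2 + real b * ln 3) - (real a' * ln 2 + real b' * ln 3))
      \<le> real_of_int B / 2048"
    using mem ln_2_bounds ln_3_bounds by (auto simp: cover_exponents_def)
  show pos: "0 < s" "s \<le> 128" using s s16 by simp_all
  have "ln (16::real) = 4 * ln 2"
    using ln_smooth[of 4 0] by simp
  moreover have "ln (real_of_int s) = real a * ln 2 + real b * ln 3"
    using ln_smooth[of a b] by (simp add: s)
  moreover have "ln (real_of_int s + 16) = real a' * ln 2 + real b' * ln 3"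
    using ln_smooth[of a' b'] s16(1)[THEN arg_cong[where f = real_of_int]] by (simp add: s)
  moreover have "1 / (1 + real_of_int s / 16) = 16 / (real_of_int s + 16)"
    "real_of_int s / 16 / (1 + real_of_int s / 16) = real_of_int s / (real_of_int s + 16)"
    using pos by (auto simp: field_simps)
  moreover have "ln (16 / (real_of_int s + 16)) = ln 16 - ln (real_of_int s + 16)"
    "ln (real_of_int s / (real_of_int s + 16)) = ln (real_of_int s) - ln (real_of_int s + 16)"
    using pos by (simp_all add: ln_div)
  moreover have "4 * ln 2 - (real a' * ln 2 + real b' * ln 3)
      + real_of_int s / 16 * ((real a * ln 2 + real b * ln 3) - (real a' * ln 2 + real b' * ln 3))
      \<le> real_of_int B / 2048"
    using le by (simp add: s)
  ultimately show "ln (1 / (1 + real_of_int s / 16))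
      + real_of_int s / 16 * ln (real_of_int s / 16 / (1 + real_of_int s / 16)) \<le> real_of_int B / 2048"
    by (simp only:)
qed

text \<open>
  Units in the check of one box: box corners \<open>l\<close>, \<open>u\<close> in 1/256; centre \<open>c\<close>, half width \<open>w\<close> and the
  tangent points \<open>p\<close> in 1/512; linear coefficients in 1/2048; quadratic coefficients \<open>s\<close>, \<open>v\<close>, \<open>d\<close>
  in 1/4. The vectors \<open>m\<close> and \<open>v\<close> and the number \<open>\<nu>\<close> are multipliers for \<open>a\<^sub>i - a\<^sub>3 \<ge> 0\<close>,
  \<open>(\<Sum>a - 1) (\<Sum>v a) = 0\<close> and \<open>\<Sum>a = 1\<close>, and \<open>d\<close> bounds the curvature of the entropy from below.
  The final comparison is in units of 1/1048576 and twice the exponent.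
\<close>

definition edge_coeff :: "vec \<Rightarrow> colour \<Rightarrow> colour \<Rightarrow> int" where
  "edge_coeff s i j = (if j = nxt i then 16 + entry s i else 0)"

text \<open>The matrix of twice the quadratic part, in quarters: 16 is the edge coefficient 4, and s
  comes from the covering tangents. On \<Sum>a = 1 the \<open>v\<close> terms cancel against 512 v
  in \<open>linear_part\<close>, so \<open>v\<close> changes the form but not the value that is
  bounded.\<close>

definition form :: "vec \<Rightarrow> vec \<Rightarrow> vec \<Rightarrow> colour \<Rightarrow> colour \<Rightarrow> int" where
  "form s v d i j = edge_coeff s i j + edge_coeff s j i - entry v i - entry v j
     - (if i = j then 2 * entry d i else 0)"

text \<open>The right-hand side of \<open>quadratic_le_on_slice\<close> multiplied by 1048576, which
  is both 512 * 2048 and 4 * 512^2.\<close>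

definition slice_bound :: "vec \<Rightarrow> vec \<Rightarrow> vec \<Rightarrow> vec \<Rightarrow> (colour \<Rightarrow> colour \<Rightarrow> int) \<Rightarrow> int \<Rightarrow> int" where
  "slice_bound c w L g N \<nu> =
     total (\<lambda>i. entry c i * (entry L i + entry g i)) + 2 * \<nu> * (512 - total (entry c))
     + 2 * total (\<lambda>i. entry w i * \<bar>entry g i - \<nu>\<bar>)
     + total (\<lambda>i. entry w i * max 0 (total (\<lambda>j. (if i = j then N i j else \<bar>N i j\<bar>) * entry w j)))"

definition gradient :: "vec \<Rightarrow> vec \<Rightarrow> (colour \<Rightarrow> colour \<Rightarrow> int) \<Rightarrow> vec" where
  "gradient c L N = tab (\<lambda>i. entry L i + total (\<lambda>j. N i j * entry c j))"

text \<open>The summand 2 d p is the cross term of - d (a - p)^2 in the entropy bound; the constant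
  - d p^2 enters \<open>leaf_ok\<close> separately.\<close>

definition linear_part :: "vec \<Rightarrow> vec \<Rightarrow> vec \<Rightarrow> vec \<Rightarrow> vec \<Rightarrow> vec \<Rightarrow> vec" where
  "linear_part p t b v m d =
     tab (\<lambda>i. entry t i + 2 * (entry d i * entry p i) + 512 * entry v i + entry m i + entry b i)"

definition centred_bound :: "vec \<Rightarrow> vec \<Rightarrow> vec \<Rightarrow> (colour \<Rightarrow> colour \<Rightarrow> int) \<Rightarrow> int \<Rightarrow> int" where
  "centred_bound c w L N \<nu> = slice_bound c w L (gradient c L N) N \<nu>"

text \<open>The third condition is the curvature hypothesis of
  \<open>neg_mult_ln_le_quadratic\<close> in these units. As \<open>m\<close> sums to zero, \<Sum>
  m_i a_i equals \<Sum> m_i (a_i - a_3), which is nonnegative. The threshold is 4190208 = 1048576 *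
  2 * (2 - 1 / 512).\<close>

definition leaf_ok :: "vec \<Rightarrow> vec \<Rightarrow> vec \<Rightarrow> vec \<Rightarrow> vec \<Rightarrow> vec \<Rightarrow> vec \<Rightarrow> vec \<Rightarrow> vec \<Rightarrow> int \<Rightarrow> bool" where
  "leaf_ok l u p t s b v m d \<nu> \<longleftrightarrow>
     each (\<lambda>i. (entry p i, entry t i) \<in> set entropy_table) \<and>
     each (\<lambda>i. if i = C0 then entry s i = 0 \<and> entry b i = 0
                else (entry s i, entry b i) \<in> set cover_table) \<and>
     each (\<lambda>i. 0 \<le> entry d i \<and> 2 * (entry d i * entry u i) \<le> 1024 \<and> entry d i * entry p i \<le> 1024) \<and>
     each (\<lambda>i. i = C3 \<or> 0 \<le> entry m i) \<and> total (entry m) = 0 \<and>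
     2 * total (\<lambda>i. entry p i * (2048 - entry d i * entry p i))
       + centred_bound (tab (\<lambda>i. entry l i + entry u i)) (tab (\<lambda>i. entry u i - entry l i))
           (linear_part p t b v m d) (form s v d) \<nu> \<le> 4190208"

text \<open>
  \<open>Lo\<close> and \<open>Hi\<close> shrink a box using \<open>\<Sum>a = 1\<close>, and \<open>Cap\<close> and \<open>Rise\<close> using \<open>a\<^sub>3 \<le> a\<^sub>i\<close>.
\<close>

datatype cert =
    Void colour
  | Leaf vec vec vec vec vec vec vec int
  | Split colour int cert cert
  | Lo colour cert
  | Hi colour cert
  | Cap colour cert
  | Rise colour cert

fun check :: "vec \<Rightarrow> vec \<Rightarrow> cert \<Rightarrow> bool" where
  "check l u (Void i) \<longleftrightarrow> entry u i < entry l i"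
| "check l u (Leaf p t s b v m d \<nu>) \<longleftrightarrow> leaf_ok l u p t s b v m d \<nu>"
| "check l u (Split i r x y) \<longleftrightarrow> check l (upd u i r) x \<and> check (upd l i r) u y"
| "check l u (Lo i x) \<longleftrightarrow> check (upd l i (256 - (total (entry u) - entry u i))) u x"
| "check l u (Hi i x) \<longleftrightarrow> check l (upd u i (256 - (total (entry l) - entry l i))) x"
| "check l u (Cap i x) \<longleftrightarrow> check l (upd u C3 (entry u i)) x"
| "check l u (Rise i x) \<longleftrightarrow> check (upd l i (entry l C3)) u x"

text \<open>Found by a greedy branch-and-bound search; only its validity matters.\<close>

definition exponent_cert :: cert where
  "exponent_cert = 
Split C3 42
(
Split C4 170
(
Split C1 192
(
Split C2 192
(
Split C1 128
(
Split C2 128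
(
Split C0 170
(
Split C4 127
(
Split C2 96
(
Split C4 21
(
Cap C4 (Split C0 28
(
Leaf (Vec 54 192 162 48 48) (Vec 2559 (-39) 309 2800 2800) (Vec 0 8 48 48 32) (Vec 0 (-1955) (-4606) (-4606) (-3910))
  (Vec 3 7 9 3 3) (Vec 0 76 180 (-256) 0) (Vec 18 4 5 21 21) 902)
(
Leaf (Vec 128 288 128 48 48) (Vec 792 (-869) 792 2800 2800) (Vec 0 16 32 48 2) (Vec 0 (-2839) (-3910) (-4606) (-803))
  (Vec 12 2 26 (-2) (-2)) (Vec 0 76 52 (-128) 0) (Vec 3 3 5 21 21) (-1438))))
(
Split C0 28
(
Cap C0 (Split C0 4
(
Cap C0 (Leaf (Vec 4 162 96 4 144) (Vec 7890 309 1381 7890 550) (Vec 0 16 128 8 128) (Vec 0 (-2839) (-6429) (-1955) (-6429))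
  (Vec 8 8 8 8 8) (Vec 0 716 308 (-1024) 0) (Vec 128 4 5 128 4) (-7223)))
(
Leaf (Vec 54 162 192 54 48) (Vec 2559 309 (-39) 2559 2800) (Vec 0 8 32 8 16) (Vec 0 (-1955) (-3910) (-1955) (-2839))
  (Vec 2 9 11 12 12) (Vec 0 204 52 (-768) 512) (Vec 18 4 5 18 4) (-2025))))
(
Split C2 64
(
Split C1 96
(
Split C2 16
(
Cap C2 (Split C1 56
(
Lo C0 (Leaf (Vec 192 24 32 32 162) (Vec (-39) 4220 3631 3631 309) (Vec 0 48 48 8 2) (Vec 0 (-4606) (-4606) (-1955) (-803))
  (Vec 10 6 (-3) (-4) 3) (Vec 0 204 308 (-512) 0) (Vec 3 9 32 32 4) 1254))
(
Leaf (Vec 288 108 32 32 72) (Vec (-869) 1140 3631 3631 1970) (Vec 0 48 48 8 2) (Vec 0 (-4606) (-4606) (-1955) (-803))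
  (Vec 8 8 (-2) (-2) 6) (Vec 0 76 308 (-384) 0) (Vec 3 5 32 32 4) 999)))
(
Split C3 7
(
Split C0 63
(
Leaf (Vec 108 162 48 18 144) (Vec 1140 309 2800 4809 550) (Vec 0 16 128 2 8) (Vec 0 (-2839) (-6429) (-803) (-1955))
  (Vec 8 3 13 3 9) (Vec 0 76 180 (-256) 0) (Vec 8 5 8 56 4) (-1726))
(
Leaf (Vec 216 162 36 16 144) (Vec (-280) 309 3390 5050 550) (Vec 0 16 48 8 2) (Vec 0 (-2839) (-4606) (-1955) (-803))
  (Vec 4 17 (-2) 14 9) (Vec 0 76 52 (-128) 0) (Vec 3 5 8 64 4) (-224)))
(
Rise C1 (Split C0 134
(
Split C0 45
(
Split C3 33
(
Split C0 32
(
Leaf (Vec 64 192 144 72 96) (Vec 2211 (-39) 550 1970 1381) (Vec 0 8 32 8 16) (Vec 0 (-1955) (-3910) (-1955) (-2839))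
  (Vec 8 3 13 9 13) (Vec 0 76 180 (-256) 0) (Vec 16 5 7 14 4) (-2054))
(
Leaf (Vec 96 192 128 64 81) (Vec 1381 (-39) 792 2211 1729) (Vec 0 8 32 8 8) (Vec 0 (-1955) (-3910) (-1955) (-1955))
  (Vec 9 12 12 5 13) (Vec 0 76 52 (-128) 0) (Vec 10 5 8 15 4) (-2135)))
(
Rise C0 (Rise C1 (Rise C2 (Rise C4 (Hi C4 (Split C0 35
(
Cap C0 (Leaf (Vec 72 128 96 72 162) (Vec 1970 792 1381 1970 309) (Vec 0 16 32 8 32) (Vec 0 (-2839) (-3910) (-1955) (-3910))
  (Vec 12 12 12 12 12) (Vec 0 716 308 (-1024) 0) (Vec 14 5 8 14 4) (-3461)))
(
Leaf (Vec 96 144 128 81 96) (Vec 1381 550 792 1729 1381) (Vec 0 8 16 16 16) (Vec 0 (-1955) (-2839) (-2839) (-2839))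
  (Vec 13 10 14 18 6) (Vec 0 716 52 (-768) 0) (Vec 10 5 8 12 4) (-3122)))))))))
(
Split C3 12
(
Split C0 59
(
Leaf (Vec 108 108 81 18 144) (Vec 1140 1140 1729 4809 550) (Vec 0 16 128 8 16) (Vec 0 (-2839) (-6429) (-1955) (-2839))
  (Vec 8 8 8 8 8) (Vec 0 716 308 (-1024) 0) (Vec 8 5 8 42 4) (-1705))
(
Leaf (Vec 192 81 32 24 96) (Vec (-39) 1729 3631 4220 1381) (Vec 0 16 48 8 2) (Vec 0 (-2839) (-4606) (-1955) (-803))
  (Vec 9 13 (-4) 20 4) (Vec 0 76 52 (-128) 0) (Vec 3 5 8 42 4) 260))
(
Split C3 17
(
Split C0 67
(
Leaf (Vec 128 192 96 32 81) (Vec 792 (-39) 1381 3631 1729) (Vec 0 16 48 8 8) (Vec 0 (-2839) (-4606) (-1955) (-1955))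
  (Vec 8 8 9 9 8) (Vec 0 76 180 (-256) 0) (Vec 7 5 8 30 4) (-1125))
(
Split C2 36
(
Leaf (Vec 216 64 72 32 128) (Vec (-280) 2211 1970 3631 792) (Vec 0 32 48 8 2) (Vec 0 (-3910) (-4606) (-1955) (-803))
  (Vec 9 7 23 13 6) (Vec 0 588 52 (-640) 0) (Vec 3 5 14 30 4) (-974))
(
Leaf (Vec 192 108 72 32 81) (Vec (-39) 1140 1970 3631 1729) (Vec 0 16 48 16 8) (Vec 0 (-2839) (-4606) (-2839) (-1955))
  (Vec 9 10 (-6) 23 6) (Vec 0 460 52 (-512) 0) (Vec 3 5 8 30 4) 743)))
(
Rise C1 (Split C1 76
(
Split C2 24
(
Cap C2 (Split C0 59
(
Leaf (Vec 108 96 36 36 192) (Vec 1140 1381 3390 3390 (-39)) (Vec 0 48 48 8 16) (Vec 0 (-4606) (-4606) (-1955) (-2839))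
  (Vec 8 8 8 8 8) (Vec 0 716 308 (-1024) 0) (Vec 8 6 21 21 4) (-969))
(
Leaf (Vec 192 48 48 48 162) (Vec (-39) 2800 2800 2800 309) (Vec 0 32 32 8 2) (Vec 0 (-3910) (-3910) (-1955) (-803))
  (Vec 8 8 (-3) 3 4) (Vec 0 588 308 (-896) 0) (Vec 3 6 21 21 4) 1181)))
(
Split C4 100
(
Split C2 30
(
Cap C2 (Split C1 51
(
Leaf (Vec 192 72 54 64 128) (Vec (-39) 1970 2559 2211 792) (Vec 0 32 32 8 8) (Vec 0 (-3910) (-3910) (-1955) (-1955))
  (Vec 11 5 0 (-4) 4) (Vec 0 716 436 (-1152) 0) (Vec 3 10 17 16 5) 1899)
(
Leaf (Vec 256 108 64 64 108) (Vec (-628) 1140 2211 2211 1140) (Vec 0 32 32 8 8) (Vec 0 (-3910) (-3910) (-1955) (-1955))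
  (Vec 10 6 (-4) 16 4) (Vec 0 76 308 (-512) 128) (Vec 3 6 16 16 5) 1038)))
(
Split C3 21
(
Split C0 59
(
Leaf (Vec 108 96 96 36 144) (Vec 1140 1381 1381 3390 550) (Vec 0 16 48 8 16) (Vec 0 (-2839) (-4606) (-1955) (-2839))
  (Vec 8 8 8 8 8) (Vec 0 716 308 (-1024) 0) (Vec 8 6 8 24 5) (-923))
(
Leaf (Vec 162 108 64 48 128) (Vec 309 1140 2211 2800 792) (Vec 0 16 32 8 8) (Vec 0 (-2839) (-3910) (-1955) (-1955))
  (Vec 8 11 (-6) 18 6) (Vec 0 76 52 (-128) 0) (Vec 3 6 8 21 5) 886))
(
Rise C1 (Split C3 24
(
Split C0 59
(
Leaf (Vec 128 162 108 48 72) (Vec 792 309 1140 2800 1970) (Vec 0 16 32 8 8) (Vec 0 (-2839) (-3910) (-1955) (-1955))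
  (Vec 8 8 9 3 13) (Vec 0 76 180 (-256) 0) (Vec 8 6 8 21 5) (-756))
(
Leaf (Vec 162 96 64 48 128) (Vec 309 1381 2211 2800 792) (Vec 0 16 32 8 8) (Vec 0 (-2839) (-3910) (-1955) (-1955))
  (Vec 7 10 (-7) 15 7) (Vec 0 76 52 (-128) 0) (Vec 3 6 8 21 5) 1137))
(
Rise C1 (Rise C4 (Split C1 63
(
Split C2 55
(
Split C3 28
(
Leaf (Vec 192 81 64 54 128) (Vec (-39) 1729 2211 2559 792) (Vec 0 16 32 8 8) (Vec 0 (-2839) (-3910) (-1955) (-1955))
  (Vec 6 10 (-6) (-6) 7) (Vec 0 76 52 (-128) 0) (Vec 3 8 9 18 5) 2326)
(
Rise C1 (Rise C4 (Split C1 54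
(
Split C3 38
(
Split C2 48
(
Split C3 30
(
Leaf (Vec 162 64 64 64 128) (Vec 309 2211 2211 2211 792) (Vec 0 16 32 8 8) (Vec 0 (-2839) (-3910) (-1955) (-1955))
  (Vec 8 8 (-5) (-8) 5) (Vec 0 76 308 (-384) 0) (Vec 3 9 10 16 5) 2586)
(
Rise C1 (Rise C4 (Split C1 44
(
Split C3 33
(
Leaf (Vec 162 64 64 64 144) (Vec 309 2211 2211 2211 550) (Vec 0 16 16 8 8) (Vec 0 (-2839) (-2839) (-1955) (-1955))
  (Vec 4 12 (-4) 17 6) (Vec 0 76 948 (-1024) 0) (Vec 3 11 10 15 5) 1320)
(
Rise C1 (Rise C2 (Rise C4 (Hi C0 (Split C1 35
(
Cap C1 (Leaf (Vec 192 72 72 72 144) (Vec (-39) 1970 1970 1970 550) (Vec 0 16 16 8 8) (Vec 0 (-2839) (-2839) (-1955) (-1955))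
  (Vec 5 11 1 11 5) (Vec 0 716 948 (-1664) 0) (Vec 4 14 10 14 5) 1303))
(
Hi C0 (Leaf (Vec 192 81 72 72 128) (Vec (-39) 1729 1970 1970 792) (Vec 0 16 16 8 8) (Vec 0 (-2839) (-2839) (-1955) (-1955))
  (Vec 10 6 (-4) 20 4) (Vec 0 332 564 (-896) 0) (Vec 4 11 10 13 5) 655))))))))
(
Hi C0 (Leaf (Vec 192 96 96 72 108) (Vec (-39) 1381 1381 1970 1140) (Vec 0 16 16 8 8) (Vec 0 (-2839) (-2839) (-1955) (-1955))
  (Vec 10 (-2) (-1) 21 2) (Vec 0 76 308 (-384) 0) (Vec 4 9 10 13 5) 1475))))))
(
Hi C0 (Leaf (Vec 162 108 96 72 128) (Vec 309 1140 1381 1970 792) (Vec 0 16 16 8 8) (Vec 0 (-2839) (-2839) (-1955) (-1955))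
  (Vec 8 8 (-4) 20 4) (Vec 0 76 52 (-128) 0) (Vec 4 9 9 13 5) 921)))
(
Rise C1 (Rise C2 (Rise C4 (Hi C0 (Split C0 54
(
Leaf (Vec 108 108 108 81 128) (Vec 1140 1140 1140 1729 792) (Vec 0 16 16 16 8) (Vec 0 (-2839) (-2839) (-2839) (-1955))
  (Vec 8 8 13 13 3) (Vec 0 76 180 (-256) 0) (Vec 9 9 9 12 5) (-488))
(
Hi C4 (Leaf (Vec 162 108 81 72 128) (Vec 309 1140 1729 1970 792) (Vec 0 16 16 8 8) (Vec 0 (-2839) (-2839) (-1955) (-1955))
  (Vec 10 6 0 9 3) (Vec 0 588 308 (-896) 0) (Vec 4 9 9 12 5) 1237))))))))
(
Hi C0 (Leaf (Vec 162 108 96 81 72) (Vec 309 1140 1381 1729 1970) (Vec 0 16 16 8 8) (Vec 0 (-2839) (-2839) (-1955) (-1955))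
  (Vec 8 (-4) 1 11 3) (Vec 0 76 180 (-256) 0) (Vec 4 8 9 12 5) 2810))))))
(
Split C2 57
(
Leaf (Vec 144 128 108 81 108) (Vec 550 792 1140 1729 1140) (Vec 0 8 16 8 8) (Vec 0 (-1955) (-2839) (-1955) (-1955))
  (Vec 5 11 (-5) 17 7) (Vec 0 76 52 (-128) 0) (Vec 3 8 8 12 5) 1231)
(
Hi C0 (Leaf (Vec 128 128 108 81 96) (Vec 792 792 1140 1729 1381) (Vec 0 8 16 8 8) (Vec 0 (-1955) (-2839) (-1955) (-1955))
  (Vec 5 11 (-6) 18 6) (Vec 0 76 52 (-128) 0) (Vec 4 8 8 12 5) 1495))))
(
Hi C0 (Split C0 56
(
Leaf (Vec 108 144 108 72 72) (Vec 1140 550 1140 1970 1970) (Vec 0 8 16 16 8) (Vec 0 (-1955) (-2839) (-2839) (-1955))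
  (Vec 7 9 17 12 7) (Vec 0 76 180 (-256) 0) (Vec 9 6 8 12 5) (-1269))
(
Hi C4 (Leaf (Vec 144 128 96 81 108) (Vec 550 792 1381 1729 1140) (Vec 0 16 16 16 8) (Vec 0 (-2839) (-2839) (-2839) (-1955))
  (Vec 4 (-2) 8 18 8) (Vec 0 76 180 (-256) 0) (Vec 4 6 8 12 6) 1664)))))))))))
(
Hi C0 (Hi C1 (Leaf (Vec 144 36 48 72 192) (Vec 550 3390 2800 1970 (-39)) (Vec 0 32 16 2 8) (Vec 0 (-3910) (-2839) (-803) (-1955))
  (Vec 15 0 0 16 0) (Vec 0 716 180 (-896) 0) (Vec 5 7 8 12 4) 2931)))))
(
Hi C0 (Hi C4 (Split C0 58
(
Leaf (Vec 128 144 144 72 72) (Vec 792 550 550 1970 1970) (Vec 0 8 16 16 8) (Vec 0 (-1955) (-2839) (-2839) (-1955))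
  (Vec 7 7 17 17 7) (Vec 0 76 180 (-896) 640) (Vec 8 5 7 12 5) (-771))
(
Hi C4 (Leaf (Vec 162 144 96 54 81) (Vec 309 550 1381 2559 1729) (Vec 0 16 32 16 8) (Vec 0 (-2839) (-3910) (-2839) (-1955))
  (Vec 4 (-7) 13 14 9) (Vec 0 76 308 (-512) 128) (Vec 4 5 8 12 5) 2765))))))))))
(
Hi C1 (Hi C4 (Split C0 140
(
Leaf (Vec 256 81 48 48 108) (Vec (-628) 1729 2800 2800 1140) (Vec 0 16 32 8 2) (Vec 0 (-2839) (-3910) (-1955) (-803))
  (Vec 0 1 0 0 0) (Vec 0 716 308 (-1024) 0) (Vec 3 6 8 12 5) 6328)
(
Hi C4 (Leaf (Vec 288 81 48 24 108) (Vec (-869) 1729 2800 4220 1140) (Vec 0 16 32 16 2) (Vec 0 (-2839) (-3910) (-2839) (-803))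
  (Vec 0 0 0 0 3) (Vec 0 716 180 (-896) 0) (Vec 3 6 8 12 5) 6817)))))))))
(
Hi C0 (Split C1 106
(
Leaf (Vec 128 192 108 48 48) (Vec 792 (-39) 1140 2800 2800) (Vec 0 16 32 8 2) (Vec 0 (-2839) (-3910) (-1955) (-803))
  (Vec 11 (-5) 13 18 4) (Vec 0 76 308 (-384) 0) (Vec 3 4 8 12 4) 2226)
(
Hi C4 (Leaf (Vec 144 216 128 36 48) (Vec 550 (-280) 792 3390 2800) (Vec 0 16 32 8 2) (Vec 0 (-2839) (-3910) (-1955) (-803))
  (Vec 7 (-2) 13 8 6) (Vec 0 76 180 (-896) 640) (Vec 3 4 8 12 4) 3068)))))
(
Split C0 99
(
Split C3 17
(
Leaf (Vec 192 128 128 32 48) (Vec (-39) 792 792 3631 2800) (Vec 0 8 48 8 8) (Vec 0 (-1955) (-4606) (-1955) (-1955))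
  (Vec 22 3 3 27 (-3)) (Vec 0 76 52 (-128) 0) (Vec 5 4 5 30 4) 908)
(
Rise C1 (Split C3 33
(
Split C2 69
(
Leaf (Vec 216 81 128 64 72) (Vec (-280) 1729 792 2211 1970) (Vec 0 8 16 16 8) (Vec 0 (-1955) (-2839) (-2839) (-1955))
  (Vec 18 (-1) (-1) 23 0) (Vec 0 76 52 (-640) 512) (Vec 4 4 7 15 4) 1495)
(
Leaf (Vec 128 128 144 64 81) (Vec 792 792 550 2211 1729) (Vec 0 8 16 16 8) (Vec 0 (-1955) (-2839) (-2839) (-1955))
  (Vec 18 2 1 33 (-1)) (Vec 128 76 52 (-768) 512) (Vec 5 4 5 15 4) 280))
(
Rise C0 (Rise C1 (Rise C4 (Hi C0 (Hi C1 (Hi C4 (Leaf (Vec 128 128 128 72 72) (Vec 792 792 792 1970 1970) (Vec 0 8 16 16 8) (Vec 0 (-1955) (-2839) (-2839) (-1955))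
  (Vec 10 6 (-1) 26 1) (Vec 0 716 52 (-768) 0) (Vec 5 5 5 12 5) 910))))))))))
(
Hi C1 (Hi C4 (Leaf (Vec 216 64 128 81 54) (Vec (-280) 2211 792 1729 2559) (Vec 0 8 32 8 2) (Vec 0 (-1955) (-3910) (-1955) (-803))
  (Vec 0 8 0 10 0) (Vec 0 844 52 (-1664) 768) (Vec 3 7 5 12 5) 6976)))))))
(
Split C3 14
(
Leaf (Vec 96 216 192 32 72) (Vec 1381 (-280) (-39) 3631 1970) (Vec 0 2 48 8 8) (Vec 0 (-803) (-4606) (-1955) (-1955))
  (Vec 6 11 1 11 1) (Vec 0 588 180 (-1408) 640) (Vec 3 4 4 32 4) 2194)
(
Rise C0 (Rise C1 (Rise C4 (Hi C0 (Hi C1 (Hi C4 (Leaf (Vec 81 128 192 72 48) (Vec 1729 792 (-39) 1970 2800) (Vec 0 2 16 16 8) (Vec 0 (-803) (-2839) (-2839) (-1955))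
  (Vec 8 9 (-3) 26 3) (Vec 0 588 52 (-1280) 640) (Vec 4 4 4 12 4) 1865)))))))))
(
Hi C0 (Split C0 53
(
Leaf (Vec 108 64 36 81 256) (Vec 1140 2211 3390 1729 (-628)) (Vec 0 16 16 2 8) (Vec 0 (-2839) (-2839) (-803) (-1955))
  (Vec 12 4 12 18 (-5)) (Vec 0 1996 1588 (-3584) 0) (Vec 9 4 4 12 3) 3301)
(
Hi C1 (Hi C2 (Split C0 78
(
Leaf (Vec 162 18 18 81 256) (Vec 309 4809 4809 1729 (-628)) (Vec 0 32 16 2 8) (Vec 0 (-3910) (-2839) (-803) (-1955))
  (Vec 8 8 13 18 (-2)) (Vec 0 716 1076 (-1792) 0) (Vec 6 6 6 12 3) 3106)
(
Hi C1 (Hi C2 (Leaf (Vec 192 24 9 81 256) (Vec (-39) 4220 6229 1729 (-628)) (Vec 0 32 16 2 8) (Vec 0 (-3910) (-2839) (-803) (-1955))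
  (Vec 7 0 0 2 0) (Vec 0 1356 436 (-1792) 0) (Vec 3 10 10 12 3) 5330)))))))))
(
Hi C1 (Hi C2 (Hi C4 (Leaf (Vec 324 72 6 12 72) (Vec (-1110) 1970 7059 5640 1970) (Vec 0 16 32 8 2) (Vec 0 (-2839) (-3910) (-1955) (-803))
  (Vec 0 2 0 0 7) (Vec 0 76 948 (-1024) 0) (Vec 2 5 5 12 5) 7433)))))
(
Hi C0 (Hi C4 (Leaf (Vec 72 144 256 81 36) (Vec 1970 550 (-628) 1729 3390) (Vec 0 2 16 8 8) (Vec 0 (-803) (-2839) (-1955) (-1955))
  (Vec 7 9 (-4) 16 2) (Vec 640 76 52 (-2048) 1280) (Vec 4 4 2 12 4) 3957))))
(
Hi C0 (Hi C2 (Hi C4 (Split C0 42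
(
Leaf (Vec 81 256 144 48 18) (Vec 1729 (-628) 550 2800 4809) (Vec 0 16 32 8 8) (Vec 0 (-2839) (-3910) (-1955) (-1955))
  (Vec 23 (-2) 19 21 2) (Vec 0 76 52 (-896) 768) (Vec 12 2 4 12 4) 2368)
(
Hi C2 (Hi C4 (Leaf (Vec 96 256 144 24 24) (Vec 1381 (-628) 550 4220 4220) (Vec 0 16 48 16 2) (Vec 0 (-2839) (-4606) (-2839) (-803))
  (Vec 0 0 8 2 0) (Vec 0 76 52 (-896) 768) (Vec 4 2 5 12 5) 7196))))))))
(
Hi C0 (Hi C4 (Leaf (Vec 64 64 432 48 64) (Vec 2211 2211 (-1699) 2800 2211) (Vec 0 2 48 32 32) (Vec 0 (-803) (-4606) (-3910) (-3910))
  (Vec 0 0 0 0 0) (Vec 0 716 308 (-1024) 0) (Vec 8 2 2 12 8) 10700))))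
(
Hi C2 (Leaf (Vec 32 384 108 24 32) (Vec 3631 (-1458) 1140 4220 3631) (Vec 0 16 48 32 32) (Vec 0 (-2839) (-4606) (-3910) (-3910))
  (Vec 0 0 5 0 0) (Vec 0 76 180 (-256) 0) (Vec 2 2 8 12 3) 17743)))
(
Hi C0 (Hi C1 (Hi C2 (Leaf (Vec 81 24 24 27 324) (Vec 1729 4220 4220 3979 (-1110)) (Vec 0 16 16 2 8) (Vec 0 (-2839) (-2839) (-803) (-1955))
  (Vec 10 0 0 5 0) (Vec 0 1356 948 (-2304) 0) (Vec 5 5 5 12 2) 10069)))))
(
Rise C0 (Rise C1 (Rise C2 (Rise C4 (Hi C0 (Hi C1 (Hi C2 (Hi C4 (Split C1 57
(
Cap C1 (Split C2 57
(
Split C4 65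
(
Leaf (Vec 128 81 96 81 144) (Vec 792 1729 1381 1729 550) (Vec 0 16 16 16 8) (Vec 0 (-2839) (-2839) (-2839) (-1955))
  (Vec 2 2 5 (-2) 23) (Vec 0 716 52 (-768) 0) (Vec 5 8 8 8 7) 1664)
(
Leaf (Vec 128 81 81 81 144) (Vec 792 1729 1729 1729 550) (Vec 0 16 16 8 8) (Vec 0 (-2839) (-2839) (-1955) (-1955))
  (Vec 5 0 0 0 0) (Vec 0 716 308 (-1024) 0) (Vec 5 8 8 8 5) 5038))
(
Hi C0 (Hi C4 (Leaf (Vec 108 96 108 108 96) (Vec 1140 1381 1140 1140 1381) (Vec 0 8 16 16 8) (Vec 0 (-1955) (-2839) (-2839) (-1955))
  (Vec 1 2 0 5 0) (Vec 0 716 180 (-1152) 256) (Vec 7 8 5 8 7) 4517)))))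
(
Hi C0 (Hi C4 (Split C3 52
(
Leaf (Vec 128 108 81 81 81) (Vec 792 1140 1729 1729 1729) (Vec 0 8 16 16 8) (Vec 0 (-1955) (-2839) (-2839) (-1955))
  (Vec 10 0 0 4 0) (Vec 0 76 308 (-512) 128) (Vec 7 5 5 9 7) 3670)
(
Rise C0 (Rise C2 (Rise C4 (Hi C0 (Void C0)))))))))))))))))"

text \<open>The search starts from the whole cube [0, 1]^5; the constraints on a enter only through
  the shrinking steps and the multipliers in the leaves.\<close>

lemma check_exponent_cert: "check (Vec 0 0 0 0 0) (Vec 256 256 256 256 256) exponent_cert"
  by code_simp

section \<open>Soundness of the certificate\<close>

lemma of_int_total: "real_of_int (total f) = (\<Sum>i\<in>UNIV. real_of_int (f i))"
  by (simp add: total_eq)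

lemma form_sym: "form s v d i j = form s v d j i"
  by (simp add: form_def)

lemma sum_form:
  fixes a :: "colour \<Rightarrow> real"
  assumes sum1: "(\<Sum>i\<in>UNIV. a i) = 1"
  shows "(\<Sum>i\<in>UNIV. \<Sum>j\<in>UNIV. real_of_int (form s v d i j) * a i * a j)
    = 2 * (\<Sum>i\<in>UNIV. (16 + real_of_int (entry s i)) * a i * a (nxt i))
      - 2 * (\<Sum>i\<in>UNIV. real_of_int (entry v i) * a i) - 2 * (\<Sum>i\<in>UNIV. real_of_int (entry d i) * (a i)\<^sup>2)"
proof -
  have edge: "(\<Sum>i\<in>UNIV. \<Sum>j\<in>UNIV. real_of_int (edge_coeff s i j) * a i * a j)
      = (\<Sum>i\<in>UNIV. (16 + real_of_int (entry s i)) * a i * a (nxt i))"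
    by (simp add: edge_coeff_def if_distrib if_distribR cong: if_cong)
  have edge': "(\<Sum>i\<in>UNIV. \<Sum>j\<in>UNIV. real_of_int (edge_coeff s j i) * a i * a j)
      = (\<Sum>i\<in>UNIV. (16 + real_of_int (entry s i)) * a i * a (nxt i))"
    unfolding edge[symmetric] by (subst sum.swap) (simp add: mult.assoc mult.left_commute mult.commute)
  have v: "(\<Sum>i\<in>UNIV. \<Sum>j\<in>UNIV. real_of_int (entry v i) * a i * a j) = (\<Sum>i\<in>UNIV. real_of_int (entry v i) * a i)"
    using sum1 by (simp add: sum_distrib_left[symmetric])
  have v': "(\<Sum>i\<in>UNIV. \<Sum>j\<in>UNIV. real_of_int (entry v j) * a i * a j) = (\<Sum>i\<in>UNIV. real_of_int (entry v i) * a i)"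
    unfolding v[symmetric] by (subst sum.swap) (simp add: mult.assoc mult.left_commute mult.commute)
  have d: "(\<Sum>i\<in>UNIV. \<Sum>j\<in>UNIV. real_of_int (if i = j then 2 * entry d i else 0) * a i * a j)
      = 2 * (\<Sum>i\<in>UNIV. real_of_int (entry d i) * (a i)\<^sup>2)"
    by (simp add: if_distrib if_distribR power2_eq_square sum_distrib_left mult.assoc cong: if_cong)
  have "(\<Sum>i\<in>UNIV. \<Sum>j\<in>UNIV. real_of_int (form s v d i j) * a i * a j)
      = (\<Sum>i\<in>UNIV. \<Sum>j\<in>UNIV. real_of_int (edge_coeff s i j) * a i * a j + real_of_int (edge_coeff s j i) * a i * a j
          - real_of_int (entry v i) * a i * a j - real_of_int (entry v j) * a i * a j
          - real_of_int (if i = j then 2 * entry d i else 0) * a i * a j)"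
    unfolding form_def of_int_add of_int_diff by (simp only: left_diff_distrib distrib_right)
  then show ?thesis
    by (simp only: sum.distrib sum_subtractf edge edge' v v' d)
qed

text \<open>This is \<open>quadratic_le_on_slice\<close> with c and w divided by 512, the linear
  data and \<nu> by 2048 and N by 4, after clearing denominators.\<close>

lemma centred_bound_sound:
  fixes a :: "colour \<Rightarrow> real"
  assumes sum1: "(\<Sum>i\<in>UNIV. a i) = 1"
    and sym: "\<And>i j. N i j = N j i"
    and w: "\<And>i. \<bar>512 * a i - real_of_int (entry c i)\<bar> \<le> real_of_int (entry w i)"
  shows "1024 * (\<Sum>i\<in>UNIV. real_of_int (entry L i) * a i)
      + 262144 * (\<Sum>i\<in>UNIV. \<Sum>j\<in>UNIV. real_of_int (N i j) * a i * a j)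
    \<le> real_of_int (centred_bound c w L N \<nu>)"
proof -
  let ?R = real_of_int
  define g where "g = gradient c L N"
  have scale: "S' \<le> A' + B' + C' + D'"
    if "S \<le> A + B + C + D" "1048576 * A = A'" "1048576 * B = B'" "1048576 * C = C'"
      "1048576 * D = D'" "1048576 * S = S'" for S A B C D S' A' B' C' D' :: real
    using that by linarith
  have "2 * (\<Sum>i\<in>UNIV. ?R (entry L i) / 2048 * a i) + (\<Sum>i\<in>UNIV. \<Sum>j\<in>UNIV. ?R (N i j) / 4 * a i * a j)
    \<le> (\<Sum>i\<in>UNIV. ?R (entry c i) / 512 * (?R (entry L i) / 2048 + ?R (entry g i) / 2048))
      + 2 * (?R \<nu> / 2048) * (1 - (\<Sum>i\<in>UNIV. ?R (entry c i) / 512))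
      + 2 * (\<Sum>i\<in>UNIV. ?R (entry w i) / 512 * \<bar>?R (entry g i) / 2048 - ?R \<nu> / 2048\<bar>)
      + (\<Sum>i\<in>UNIV. ?R (entry w i) / 512 * max 0 (\<Sum>j\<in>UNIV. (if i = j then ?R (N i j) / 4 else \<bar>?R (N i j) / 4\<bar>) * (?R (entry w j) / 512)))"
  proof (rule quadratic_le_on_slice)
    show "\<bar>a i - ?R (entry c i) / 512\<bar> \<le> ?R (entry w i) / 512" for i
      using w[of i] by (simp add: abs_le_iff field_simps)
    show "?R (entry g i) / 2048 = ?R (entry L i) / 2048 + (\<Sum>j\<in>UNIV. ?R (N i j) / 4 * (?R (entry c j) / 512))" for i
      by (simp add: g_def gradient_def of_int_total add_divide_distrib sum_divide_distrib)
  qed (use sum1 sym in simp_all)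
  moreover have "1048576 * (\<Sum>i\<in>UNIV. ?R (entry c i) / 512 * (?R (entry L i) / 2048 + ?R (entry g i) / 2048))
      = ?R (total (\<lambda>i. entry c i * (entry L i + entry g i)))"
    by (simp add: of_int_total sum_distrib_left add_divide_distrib[symmetric])
  moreover have "1048576 * (2 * (?R \<nu> / 2048) * (1 - (\<Sum>i\<in>UNIV. ?R (entry c i) / 512))) = ?R (2 * \<nu> * (512 - total (entry c)))"
    by (simp add: of_int_total sum_divide_distrib[symmetric] algebra_simps)
  moreover have "1048576 * (2 * (\<Sum>i\<in>UNIV. ?R (entry w i) / 512 * \<bar>?R (entry g i) / 2048 - ?R \<nu> / 2048\<bar>))
      = ?R (2 * total (\<lambda>i. entry w i * \<bar>entry g i - \<nu>\<bar>))"
    by (simp add: of_int_total sum_distrib_left diff_divide_distrib[symmetric])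
  moreover have "1048576 * (\<Sum>i\<in>UNIV. ?R (entry w i) / 512 * max 0 (\<Sum>j\<in>UNIV. (if i = j then ?R (N i j) / 4 else \<bar>?R (N i j) / 4\<bar>) * (?R (entry w j) / 512)))
      = ?R (total (\<lambda>i. entry w i * max 0 (total (\<lambda>j. (if i = j then N i j else \<bar>N i j\<bar>) * entry w j))))"
  proof -
    have mx: "2048 * max 0 (\<Sum>j\<in>UNIV. (if i = j then ?R (N i j) / 4 else \<bar>?R (N i j) / 4\<bar>) * (?R (entry w j) / 512))
      = ?R (max 0 (total (\<lambda>j. (if i = j then N i j else \<bar>N i j\<bar>) * entry w j)))" for i
    proof -
      have "(\<Sum>j\<in>UNIV. (if i = j then ?R (N i j) / 4 else \<bar>?R (N i j) / 4\<bar>) * (?R (entry w j) / 512))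
        = ?R (total (\<lambda>j. (if i = j then N i j else \<bar>N i j\<bar>) * entry w j)) / 2048"
        unfolding of_int_total sum_divide_distrib by (intro sum.cong) auto
      then show ?thesis by (simp add: max_def)
    qed
    show ?thesis
      unfolding sum_distrib_left of_int_total of_int_mult mx[symmetric]
      by (intro sum.cong) simp_all
  qed
  moreover have "1048576 * (2 * (\<Sum>i\<in>UNIV. ?R (entry L i) / 2048 * a i) + (\<Sum>i\<in>UNIV. \<Sum>j\<in>UNIV. ?R (N i j) / 4 * a i * a j))
      = 1024 * (\<Sum>i\<in>UNIV. ?R (entry L i) * a i) + 262144 * (\<Sum>i\<in>UNIV. \<Sum>j\<in>UNIV. ?R (N i j) * a i * a j)"
    unfolding distrib_left sum_distrib_left by (intro arg_cong2[where f = "(+)"] sum.cong) simp_all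
  ultimately show ?thesis
    unfolding centred_bound_def slice_bound_def g_def[symmetric] of_int_add by (rule scale)
qed

text \<open>X_i abstracts the covering term: only its position below the tangents of the table
  matters. Adding these tangents to the entropy bounds gives a quadratic function of a; the
  nonnegative sum \<Sum> m_i a_i is added to it before \<open>centred_bound_sound\<close>
  applies.\<close>

lemma leaf_sound:
  fixes a X :: "colour \<Rightarrow> real"
  assumes ok: "leaf_ok l u p t s b v m d \<nu>"
    and a0: "\<And>i. 0 \<le> a i" and sum1: "(\<Sum>i\<in>UNIV. a i) = 1" and min: "\<And>i. a C3 \<le> a i"
    and box: "\<And>i. real_of_int (entry l i) \<le> 256 * a i" "\<And>i. 256 * a i \<le> real_of_int (entry u i)"
    and X0: "X C0 \<le> 0"
    and X: "\<And>i s B. i \<noteq> C0 \<Longrightarrow> (s, B) \<in> set cover_table \<Longrightarrow>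
      X i \<le> a i * (real_of_int s / 4 * a (nxt i) + real_of_int B / 2048)"
  shows "(\<Sum>i\<in>UNIV. 4 * a i * a (nxt i) - a i * ln (a i) + X i) \<le> 2 - 1 / 512"
proof -
  let ?R = real_of_int
  define L where "L = linear_part p t b v m d"
  define N where "N = form s v d"
  define c where "c = tab (\<lambda>i. entry l i + entry u i)"
  define w where "w = tab (\<lambda>i. entry u i - entry l i)"
  have pt: "(entry p i, entry t i) \<in> set entropy_table" for i
    using ok by (simp add: leaf_ok_def each_iff)
  have sb: "if i = C0 then entry s i = 0 \<and> entry b i = 0 else (entry s i, entry b i) \<in> set cover_table" for i
    using ok unfolding leaf_ok_def each_iff by blast
  have d: "0 \<le> entry d i" "2 * (entry d i * entry u i) \<le> 1024" "entry d i * entry p i \<le> 1024" for i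
    using ok by (simp_all add: leaf_ok_def each_iff)
  have m: "i = C3 \<or> 0 \<le> entry m i" "total (entry m) = 0" for i
    using ok by (simp_all add: leaf_ok_def each_iff)
  have bound: "2 * total (\<lambda>i. entry p i * (2048 - entry d i * entry p i)) + centred_bound c w L N \<nu> \<le> 4190208"
    using ok by (simp add: leaf_ok_def c_def w_def L_def N_def)
  have ent: "- a i * ln (a i) \<le> a i * (?R (entry t i) / 2048) + ?R (entry p i) / 512
      - ?R (entry d i) / 4 * (a i - ?R (entry p i) / 512)\<^sup>2" for i
  proof (rule neg_mult_ln_le_quadratic[OF a0])
    show "a i \<le> ?R (entry u i) / 256" using box(2)[of i] by simp
    show "0 < ?R (entry p i) / 512" using entropy_tableD(1)[OF pt] by simp
    show "- ln (?R (entry p i) / 512) - 1 \<le> ?R (entry t i) / 2048" by (rule entropy_tableD(2)[OF pt])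
    have "?R (2 * (entry d i * entry u i)) \<le> ?R 1024" using d(2) by (simp only: of_int_le_iff)
    then show "2 * (?R (entry d i) / 4) * (?R (entry u i) / 256) \<le> 1" by simp
    have "?R (entry d i * entry p i) \<le> ?R 1024" using d(3) by (simp only: of_int_le_iff)
    then show "2 * (?R (entry d i) / 4) * (?R (entry p i) / 512) \<le> 1" by simp
  qed (use d(1)[of i] in simp)
  have X': "X i \<le> a i * (?R (entry s i) / 4 * a (nxt i) + ?R (entry b i) / 2048)" for i
  proof (cases "i = C0")
    case True then show ?thesis using X0 sb[of i] by simp
  next
    case False then show ?thesis using X sb[of i] by simp
  qed
  have "0 \<le> (\<Sum>i\<in>UNIV. ?R (entry m i) * (a i - a C3))"
  proof (intro sum_nonneg)
    fix i
    show "0 \<le> ?R (entry m i) * (a i - a C3)" using m(1)[of i] min[of i] by auto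
  qed
  also have "\<dots> = (\<Sum>i\<in>UNIV. ?R (entry m i) * a i) - ?R (total (entry m)) * a C3"
    by (simp add: right_diff_distrib sum_subtractf of_int_total sum_distrib_right)
  finally have m0: "0 \<le> (\<Sum>i\<in>UNIV. ?R (entry m i) * a i)" by (simp add: m(2))
  have "4 * a i * a (nxt i) - a i * ln (a i) + X i
      \<le> (16 + ?R (entry s i)) * a i * a (nxt i) / 4
        + ?R (entry t i + 2 * (entry d i * entry p i) + entry b i) * a i / 2048
        - ?R (entry d i) * (a i)\<^sup>2 / 4 + ?R (entry p i * (2048 - entry d i * entry p i)) / 1048576" for i
    using add_mono[OF ent[of i] X'[of i]] by (simp add: power2_eq_square field_simps)
  then have "(\<Sum>i\<in>UNIV. 4 * a i * a (nxt i) - a i * ln (a i) + X i)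
     \<le> (\<Sum>i\<in>UNIV. (16 + ?R (entry s i)) * a i * a (nxt i) / 4
        + ?R (entry t i + 2 * (entry d i * entry p i) + entry b i) * a i / 2048
        - ?R (entry d i) * (a i)\<^sup>2 / 4 + ?R (entry p i * (2048 - entry d i * entry p i)) / 1048576)"
    by (intro sum_mono)
  also have "\<dots> = (\<Sum>i\<in>UNIV. (16 + ?R (entry s i)) * a i * a (nxt i)) / 4
        + (\<Sum>i\<in>UNIV. ?R (entry t i + 2 * (entry d i * entry p i) + entry b i) * a i) / 2048
        - (\<Sum>i\<in>UNIV. ?R (entry d i) * (a i)\<^sup>2) / 4
        + ?R (total (\<lambda>i. entry p i * (2048 - entry d i * entry p i))) / 1048576"
    by (simp only: sum.distrib sum_subtractf sum_divide_distrib of_int_total)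
  finally have main: "(\<Sum>i\<in>UNIV. 4 * a i * a (nxt i) - a i * ln (a i) + X i) \<le> \<dots>" .
  have "(\<Sum>i\<in>UNIV. ?R (entry L i) * a i) = (\<Sum>i\<in>UNIV. ?R (entry t i + 2 * (entry d i * entry p i) + entry b i) * a i)
      + 512 * (\<Sum>i\<in>UNIV. ?R (entry v i) * a i) + (\<Sum>i\<in>UNIV. ?R (entry m i) * a i)"
    unfolding sum_distrib_left sum.distrib[symmetric]
    by (intro sum.cong) (simp_all add: L_def linear_part_def algebra_simps)
  moreover have "1024 * (\<Sum>i\<in>UNIV. ?R (entry L i) * a i)
      + 262144 * (\<Sum>i\<in>UNIV. \<Sum>j\<in>UNIV. ?R (N i j) * a i * a j) \<le> ?R (centred_bound c w L N \<nu>)"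
  proof (rule centred_bound_sound[OF sum1])
    show "N i j = N j i" for i j by (simp add: N_def form_sym)
    show "\<bar>512 * a i - ?R (entry c i)\<bar> \<le> ?R (entry w i)" for i
      using box[of i] by (simp add: c_def w_def abs_le_iff)
  qed
  moreover have "?R (2 * total (\<lambda>i. entry p i * (2048 - entry d i * entry p i)) + centred_bound c w L N \<nu>) \<le> ?R 4190208"
    using bound by (simp only: of_int_le_iff)
  ultimately show ?thesis
    using main m0 sum_form[OF sum1, of s v d] unfolding N_def by simp
qed

text \<open>Every constructor passes to a box that still contains a. \<open>Split\<close> has two
  candidates, one of which does; the shrinking steps install bounds implied by \<Sum>a = 1 or by a_3
  <= a_i, correct even if not sharper than the old ones. A void box contains no point.\<close>

lemma check_sound:
  fixes a X :: "colour \<Rightarrow> real"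
  assumes "check l u x"
    and a0: "\<And>i. 0 \<le> a i" and sum1: "(\<Sum>i\<in>UNIV. a i) = 1" and min: "\<And>i. a C3 \<le> a i"
    and "\<And>i. real_of_int (entry l i) \<le> 256 * a i" "\<And>i. 256 * a i \<le> real_of_int (entry u i)"
    and X0: "X C0 \<le> 0"
    and X: "\<And>i s B. i \<noteq> C0 \<Longrightarrow> (s, B) \<in> set cover_table \<Longrightarrow>
      X i \<le> a i * (real_of_int s / 4 * a (nxt i) + real_of_int B / 2048)"
  shows "(\<Sum>i\<in>UNIV. 4 * a i * a (nxt i) - a i * ln (a i) + X i) \<le> 2 - 1 / 512"
  using assms(1,5,6)
proof (induction l u x rule: check.induct)
  case (1 l u i)
  then show ?case by (smt (verit) check.simps(1) of_int_less_iff)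
next
  case (2 l u p t s b v m d \<nu>)
  then show ?case by (intro leaf_sound[OF _ a0 sum1 min _ _ X0 X]) auto
next
  case (3 l u i r x y)
  show ?case
  proof (cases "256 * a i \<le> real_of_int r")
    case True
    then show ?thesis using 3 by (intro "3.IH"(1)) (auto simp: entry_upd)
  next
    case False
    then show ?thesis using 3 by (intro "3.IH"(2)) (auto simp: entry_upd)
  qed
next
  case (4 l u i x)
  have "256 * (\<Sum>j\<in>UNIV. a j) - 256 * a i \<le> real_of_int (total (entry u)) - real_of_int (entry u i)"
    using 4(4) unfolding of_int_total sum_distrib_left
    by (simp add: sum_diff1[symmetric] sum.remove[of UNIV i] sum_mono)
  then show ?case using 4 sum1 by (intro "4.IH") (auto simp: entry_upd)
next
  case (5 l u i x)
  have "real_of_int (total (entry l)) - real_of_int (entry l i) \<le> 256 * (\<Sum>j\<in>UNIV. a j) - 256 * a i"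
    using 5(3) unfolding of_int_total sum_distrib_left
    by (simp add: sum_diff1[symmetric] sum.remove[of UNIV i] sum_mono)
  then show ?case using 5 sum1 by (intro "5.IH") (auto simp: entry_upd)
next
  case (6 l u i x)
  have "256 * a C3 \<le> real_of_int (entry u i)" using min[of i] 6(4)[of i] by simp
  then show ?case using 6 by (intro "6.IH") (auto simp: entry_upd)
next
  case (7 l u i x)
  have "real_of_int (entry l C3) \<le> 256 * a i" using min[of i] 7(3)[of C3] by simp
  then show ?case using 7 by (intro "7.IH") (auto simp: entry_upd)
qed

text \<open>
  The constant slightly above 4 leaves room for \<open>(1 - 4 / n) ^ m\<close> being smaller than \<open>exp (- 4 m / n)\<close>.
\<close>

lemma exponent_le:
  fixes a :: "colour \<Rightarrow> real"
  assumes a0: "\<And>i. 0 \<le> a i" and sum1: "(\<Sum>i\<in>UNIV. a i) = 1" and min: "\<And>i. a C3 \<le> a i"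
    and pos: "\<And>i. i \<noteq> C0 \<Longrightarrow> 0 < a i \<Longrightarrow> 0 < a (nxt i)"
  shows "(\<Sum>i\<in>UNIV. 4 * a i * a (nxt i) - a i * ln (a i)
      + (if i = C0 then 0 else a i * ln (1 - exp (- ((4 + 1 / 100000) * a (nxt i)))))) \<le> 2 - 1 / 1000"
proof -
  define Y where "Y i = (if i = C0 then 0 else a i * ln (1 - exp (- ((4 + 1 / 100000) * a (nxt i)))))" for i
  have a1: "a i \<le> 1" for i
    using sum1 a0 member_le_sum[of i UNIV a] by simp
  \<comment> \<open>Replacing 4 by 4 + 1 / 100000 raises a tangent by at most 128 / 1600000, which
    is below 1 / 10000. The subtracted amounts add up to 1 / 10000, and 1 / 512 - 1 / 10000 still
    exceeds 1 / 1000.\<close>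
  have Y: "Y i - a i / 10000 \<le> a i * (real_of_int s / 4 * a (nxt i) + real_of_int B / 2048)"
    if "i \<noteq> C0" "(s, B) \<in> set cover_table" for i s B
  proof (cases "a i = 0")
    case True
    then show ?thesis by (simp add: Y_def)
  next
    case False
    then have ai: "0 < a i" using a0[of i] by simp
    then have x: "0 < (4 + 1 / 100000) * a (nxt i)" using pos[OF that(1)] by simp
    note s = cover_tableD[OF that(2)]
    have "ln (1 - exp (- ((4 + 1 / 100000) * a (nxt i))))
        \<le> real_of_int s / 16 * ((4 + 1 / 100000) * a (nxt i)) + real_of_int B / 2048"
      using ln_one_minus_exp_le[OF x, of "real_of_int s / 16"] s by simp
    also have "\<dots> = real_of_int s / 4 * a (nxt i) + real_of_int B / 2048 + real_of_int s * a (nxt i) / 1600000"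
      by (simp add: field_simps)
    also have "real_of_int s * a (nxt i) / 1600000 \<le> 1 / 10000"
      using mult_mono[of "real_of_int s" 128 "a (nxt i)" 1] s a0 a1 by simp
    finally have "a i * ln (1 - exp (- ((4 + 1 / 100000) * a (nxt i))))
        \<le> a i * (real_of_int s / 4 * a (nxt i) + real_of_int B / 2048 + 1 / 10000)"
      using ai by (intro mult_left_mono) auto
    then show ?thesis using that by (simp add: Y_def algebra_simps)
  qed
  have "(\<Sum>i\<in>UNIV. 4 * a i * a (nxt i) - a i * ln (a i) + (Y i - a i / 10000)) \<le> 2 - 1 / 512"
  proof (rule check_sound[OF check_exponent_cert a0 sum1 min _ _ _ Y])
    show "Y C0 - a C0 / 10000 \<le> 0" using a0[of C0] by (simp add: Y_def)
    fix i
    show "real_of_int (entry (Vec 0 0 0 0 0) i) \<le> 256 * a i" using a0[of i] by (cases i) simp_all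
    show "256 * a i \<le> real_of_int (entry (Vec 256 256 256 256 256) i)" using a1[of i] by (cases i) simp_all
  qed
  moreover have "(\<Sum>i\<in>UNIV. 4 * a i * a (nxt i) - a i * ln (a i) + (Y i - a i / 10000))
      = (\<Sum>i\<in>UNIV. 4 * a i * a (nxt i) - a i * ln (a i) + Y i) - (\<Sum>i\<in>UNIV. a i) / 10000"
    by (simp add: sum_subtractf sum_divide_distrib add_diff_eq)
  ultimately show ?thesis using sum1 by (simp add: Y_def)
qed

section \<open>The first moment\<close>

text \<open>The product reflects independence of disjoint edge sets. \<open>A\<close> stays
  arbitrary in the induction over \<open>J\<close>, since each step uses the hypothesis for two sets
  of absent edges; a block may join \<open>A\<close> because it is disjoint from \<open>A\<close>
  and from the remaining blocks.\<close>

lemma prob_Pi_pmf_blocks: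
  fixes I :: "'e set" and B :: "'v \<Rightarrow> 'e set"
  assumes I: "finite I" and p: "0 \<le> p" "p \<le> 1" and J: "finite J"
    and A: "A \<subseteq> I" and B: "\<And>v. v \<in> J \<Longrightarrow> B v \<subseteq> I" "\<And>v. v \<in> J \<Longrightarrow> A \<inter> B v = {}"
    and disj: "disjoint_family_on B J"
  shows "measure_pmf.prob (Pi_pmf I False (\<lambda>_. bernoulli_pmf p))
      {x. (\<forall>e\<in>A. \<not> x e) \<and> (\<forall>v\<in>J. \<exists>e\<in>B v. x e)}
    = (1 - p) ^ card A * (\<Prod>v\<in>J. 1 - (1 - p) ^ card (B v))"
  using J A B disj
proof (induction J arbitrary: A rule: finite_induct)
  case empty
  let ?F = "\<lambda>e. if e \<in> A then {False} else UNIV"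
  have "{x. \<forall>e\<in>A. \<not> x e} = Pi I ?F"
    using empty by (auto simp: Pi_def)
  then have "measure_pmf.prob (Pi_pmf I False (\<lambda>_. bernoulli_pmf p)) {x. \<forall>e\<in>A. \<not> x e}
      = (\<Prod>e\<in>I. measure_pmf.prob (bernoulli_pmf p) (?F e))"
    using I by (simp add: measure_Pi_pmf_Pi)
  also have "\<dots> = (\<Prod>e\<in>I. if e \<in> A then 1 - p else 1)"
    using p by (intro prod.cong) (auto simp: measure_pmf_single)
  also have "\<dots> = (1 - p) ^ card A"
    using I empty by (simp add: prod.If_cases Int_absorb1)
  finally show ?case by simp
next
  case (insert w J)
  let ?M = "measure_pmf (Pi_pmf I False (\<lambda>_. bernoulli_pmf p))"
  let ?E = "\<lambda>A. {x. (\<forall>e\<in>A. \<not> x e) \<and> (\<forall>v\<in>J. \<exists>e\<in>B v. x e)}"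
  have fin: "finite A" "finite (B w)" using insert.prems I by (auto intro: finite_subset)
  have disj: "B v \<inter> B w = {}" if "v \<in> J" for v
    using insert.prems(4) insert.hyps that by (auto simp: disjoint_family_on_def)
  have disjJ: "disjoint_family_on B J"
    using insert.prems(4) by (auto simp: disjoint_family_on_def)
  \<comment> \<open>Complementing the condition for \<open>w\<close> adds \<open>B w\<close> to the absent edges.\<close>
  have "{x. (\<forall>e\<in>A. \<not> x e) \<and> (\<forall>v\<in>insert w J. \<exists>e\<in>B v. x e)} = ?E A - ?E (A \<union> B w)"
    by auto
  then have "measure ?M {x. (\<forall>e\<in>A. \<not> x e) \<and> (\<forall>v\<in>insert w J. \<exists>e\<in>B v. x e)}
      = measure ?M (?E A) - measure ?M (?E (A \<union> B w))"
    by (simp add: measure_pmf.finite_measure_Diff Collect_mono_iff)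
  also have "measure ?M (?E A) = (1 - p) ^ card A * (\<Prod>v\<in>J. 1 - (1 - p) ^ card (B v))"
    using insert.prems disjJ by (intro insert.IH) auto
  also have "measure ?M (?E (A \<union> B w)) = (1 - p) ^ card (A \<union> B w) * (\<Prod>v\<in>J. 1 - (1 - p) ^ card (B v))"
    using insert.prems disjJ disj by (intro insert.IH) blast+
  also have "card (A \<union> B w) = card A + card (B w)"
    using insert.prems fin by (intro card_Un_disjoint) auto
  finally show ?case using insert.hyps by (simp add: power_add algebra_simps)
qed

text \<open>Minimality of class \<open>C3\<close> depends on \<open>h\<close> alone and is therefore
  left to the index set of the union bound.\<close>

definition tight_event :: "'a set \<Rightarrow> ('a \<Rightarrow> colour) \<Rightarrow> ('a set \<Rightarrow> bool) set" where
  "tight_event V h = {x. (\<forall>u\<in>V. \<forall>v\<in>V. u \<noteq> v \<longrightarrow> x {u, v} \<longrightarrow> adj (h u) (h v))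
     \<and> (\<forall>v\<in>V. h v \<noteq> C0 \<longrightarrow> (\<exists>u\<in>V. x {v, u} \<and> h u = nxt (h v)))}"

text \<open>Without loops and 2-cycles under \<open>nxt\<close>, a pair between consecutive classes
  has exactly one orientation: it is counted once and can serve as forward edge for only one
  endpoint.\<close>

lemma nxt_neq: "nxt i \<noteq> i" "nxt (nxt i) \<noteq> i"
  by (cases i; simp)+

text \<open>\<open>G\<close> consists of the pairs between adjacent classes; all other pairs must be
  absent. The possible forward edges of a vertex v form the star \<open>B v\<close> inside
  \<open>G\<close>, and the stars of different vertices are disjoint. The second claim makes the
  natural subtraction in the exponent genuine.\<close>

lemma prob_tight_event:
  fixes V :: "'a set" and h :: "'a \<Rightarrow> colour"
  assumes V: "finite V" and p: "0 \<le> p" "p \<le> 1"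
  defines "n \<equiv> \<lambda>i. card (col_class V h i)"
  shows "measure_pmf.prob (Pi_pmf (vertex_pairs V) False (\<lambda>_. bernoulli_pmf p)) (tight_event V h)
    = (1 - p) ^ ((card V choose 2) - (\<Sum>i\<in>UNIV. n i * n (nxt i)))
      * (\<Prod>i\<in>UNIV. if i = C0 then 1 else (1 - (1 - p) ^ n (nxt i)) ^ n i)"
    and "(\<Sum>i\<in>UNIV. n i * n (nxt i)) \<le> card V choose 2"
proof -
  define I where "I = vertex_pairs V"
  define J where "J = {v \<in> V. h v \<noteq> C0}"
  define S where "S = (SIGMA v:V. col_class V h (nxt (h v)))"
  define G where "G = (\<lambda>(v, u). {v, u}) ` S"
  define B where "B v = (\<lambda>u. {v, u}) ` col_class V h (nxt (h v))" for v
  have I: "finite I" unfolding I_def vertex_pairs_def using V by (rule_tac finite_subset[of _ "Pow V"]) auto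
  have cI: "card I = card V choose 2" unfolding I_def vertex_pairs_def using V by (rule n_subsets)
  have S: "(v, u) \<in> S \<longleftrightarrow> v \<in> V \<and> u \<in> V \<and> h u = nxt (h v)" for v u
    by (auto simp: S_def col_class_def)
  have G_mem: "{v, u} \<in> G \<longleftrightarrow> v \<in> V \<and> u \<in> V \<and> adj (h v) (h u)" for v u
    by (auto simp: G_def image_iff S adj_def doubleton_eq_iff Bex_def)
  have "S \<subseteq> V \<times> V" by (auto simp: S)
  then have GI: "G \<subseteq> I"
    by (auto simp: G_def I_def vertex_pairs_def S card_2_iff) (metis nxt_neq(1))
  have "inj_on (\<lambda>(v, u). {v, u}) S"
    by (rule inj_onI) (auto simp: S doubleton_eq_iff nxt_neq nxt_neq[symmetric])
  then have "card G = card S" unfolding G_def by (rule card_image)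
  also have "\<dots> = (\<Sum>v\<in>V. n (nxt (h v)))"
    unfolding S_def n_def using V by (intro card_SigmaI) auto
  also have "\<dots> = (\<Sum>i\<in>UNIV. n i * n (nxt i))"
    unfolding n_def using sum_col_class[OF V, of "\<lambda>i. card (col_class V h (nxt i))" h] by simp
  finally have cG: "card G = (\<Sum>i\<in>UNIV. n i * n (nxt i))" .
  show "(\<Sum>i\<in>UNIV. n i * n (nxt i)) \<le> card V choose 2"
    using card_mono[OF I GI] by (simp add: cG cI)
  have BG: "B v \<subseteq> G" if "v \<in> V" for v
    using that by (auto simp: B_def col_class_def G_mem adj_def)
  have cB: "card (B v) = n (nxt (h v))" if "v \<in> V" for v
    unfolding B_def n_def using that by (intro card_image inj_onI) (auto simp: doubleton_eq_iff)
  have IG: "e \<in> I - G \<longleftrightarrow> (\<exists>u v. e = {u, v} \<and> u \<in> V \<and> v \<in> V \<and> u \<noteq> v \<and> \<not> adj (h u) (h v))" for e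
    by (auto simp: I_def vertex_pairs_def card_2_iff G_mem) blast
  have "tight_event V h = {x. (\<forall>e\<in>I - G. \<not> x e) \<and> (\<forall>v\<in>J. \<exists>e\<in>B v. x e)}"
    unfolding tight_event_def Ball_def IG by (auto simp: J_def B_def col_class_def)
  moreover have "measure_pmf.prob (Pi_pmf I False (\<lambda>_. bernoulli_pmf p)) {x. (\<forall>e\<in>I - G. \<not> x e) \<and> (\<forall>v\<in>J. \<exists>e\<in>B v. x e)}
      = (1 - p) ^ card (I - G) * (\<Prod>v\<in>J. 1 - (1 - p) ^ card (B v))"
  proof (rule prob_Pi_pmf_blocks[OF I p])
    show "finite J" using V by (simp add: J_def)
    show "disjoint_family_on B J"
    proof (unfold disjoint_family_on_def, intro ballI impI)
      fix v w assume "v \<in> J" "w \<in> J" "v \<noteq> w"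
      then show "B v \<inter> B w = {}"
        by (auto simp: B_def col_class_def doubleton_eq_iff nxt_neq nxt_neq[symmetric])
    qed
    show "B v \<subseteq> I" "(I - G) \<inter> B v = {}" if "v \<in> J" for v
      using BG[of v] GI that by (auto simp: J_def)
  qed auto
  moreover have "card (I - G) = (card V choose 2) - (\<Sum>i\<in>UNIV. n i * n (nxt i))"
    using I GI by (simp add: card_Diff_subset finite_subset cI cG)
  moreover have "(\<Prod>v\<in>J. 1 - (1 - p) ^ card (B v)) = (\<Prod>v\<in>V. if h v = C0 then 1 else 1 - (1 - p) ^ n (nxt (h v)))"
  proof -
    have "(\<Prod>v\<in>J. 1 - (1 - p) ^ card (B v)) = (\<Prod>v\<in>J. if h v = C0 then 1 else 1 - (1 - p) ^ n (nxt (h v)))"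
      by (intro prod.cong) (auto simp: J_def cB)
    also have "\<dots> = (\<Prod>v\<in>V. if h v = C0 then 1 else 1 - (1 - p) ^ n (nxt (h v)))"
      using V by (intro prod.mono_neutral_left) (auto simp: J_def)
    finally show ?thesis .
  qed
  moreover have "(\<Prod>v\<in>V. if h v = C0 then 1 else 1 - (1 - p) ^ n (nxt (h v)))
      = (\<Prod>i\<in>UNIV. if i = C0 then 1 else (1 - (1 - p) ^ n (nxt i)) ^ n i)"
    unfolding n_def using prod_col_class[OF V, of "\<lambda>i. if i = C0 then 1 else 1 - (1 - p) ^ card (col_class V h (nxt i))" h]
    by (simp add: if_distrib[of "\<lambda>x. x ^ _"] cong: if_cong)
  ultimately show "measure_pmf.prob (Pi_pmf (vertex_pairs V) False (\<lambda>_. bernoulli_pmf p)) (tight_event V h)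
    = (1 - p) ^ ((card V choose 2) - (\<Sum>i\<in>UNIV. n i * n (nxt i)))
      * (\<Prod>i\<in>UNIV. if i = C0 then 1 else (1 - (1 - p) ^ n (nxt i)) ^ n i)"
    by (simp add: I_def)
qed

text \<open>By 1 + z <= exp z it suffices that (1 - 4 x) (1 + (4 + 1 / 100000) x) >= 1 for x = 1 /
  n, that is, (16 + 4 / 100000) x <= 1 / 100000. The threshold 2000000 is chosen for this.\<close>

lemma one_minus_four_div_ge_exp:
  assumes n: "n \<ge> 2000000"
  shows "exp (- ((4 + 1 / 100000) / real n)) \<le> 1 - 4 / real n"
proof -
  define x where "x = 1 / real n"
  have x: "0 < x" "x \<le> 1 / 2000000" using n by (auto simp: x_def field_simps)
  have "(1 - 4 * x) * (1 + (4 + 1 / 100000) * x) = 1 + x * (1 / 100000 - (16 + 4 / 100000) * x)"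
    by (simp add: field_simps)
  moreover have "0 \<le> x * (1 / 100000 - (16 + 4 / 100000) * x)"
    using x by (intro mult_nonneg_nonneg) auto
  ultimately have "1 \<le> (1 - 4 * x) * (1 + (4 + 1 / 100000) * x)" by simp
  also have "\<dots> \<le> (1 - 4 * x) * exp ((4 + 1 / 100000) * x)"
    using x by (intro mult_left_mono exp_ge_add_one_self) auto
  finally have "exp (- ((4 + 1 / 100000) * x)) \<le> 1 - 4 * x"
    by (simp add: exp_minus field_simps)
  then show ?thesis by (simp add: x_def)
qed

text \<open>\<open>exponent_le\<close> is applied to the relative class sizes a_i. The entropy is
  left as the product of these sizes over the vertices, equal to exp (n \<Sum> a_i ln a_i); in this
  form the sum over all \<open>h\<close> needs no estimate of factorials.\<close>

lemma prob_tight_event_le: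
  fixes V :: "'a set" and h :: "'a \<Rightarrow> colour"
  assumes V: "finite V" and large: "card V \<ge> 2000000"
    and min: "\<And>i. card (col_class V h C3) \<le> card (col_class V h i)"
  shows "measure_pmf.prob (Pi_pmf (vertex_pairs V) False (\<lambda>_. bernoulli_pmf (4 / real (card V)))) (tight_event V h)
    \<le> exp (2 - real (card V) / 1000) * (\<Prod>v\<in>V. real (card (col_class V h (h v))) / real (card V))"
proof -
  define n where "n = card V"
  define k where "k i = card (col_class V h i)" for i
  define a where "a i = real (k i) / real n" for i
  define p where "p = 4 / real n"
  define K where "K = (\<Sum>i\<in>UNIV. k i * k (nxt i))"
  have n: "n \<ge> 2000000" "0 < real n" using large by (auto simp: n_def)
  have p: "0 \<le> p" "p \<le> 1" using n by (auto simp: p_def)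
  have ka: "real (k i) = real n * a i" for i using n by (simp add: a_def)
  have a0: "0 \<le> a i" for i by (simp add: a_def)
  have "(\<Sum>i\<in>UNIV. real (k i)) = real n"
    using sum_card_col_class[OF V, of h] unfolding n_def k_def by (metis of_nat_sum)
  then have sum1: "(\<Sum>i\<in>UNIV. a i) = 1"
    using n by (simp add: a_def sum_divide_distrib[symmetric])
  have prob: "measure_pmf.prob (Pi_pmf (vertex_pairs V) False (\<lambda>_. bernoulli_pmf p)) (tight_event V h)
    = (1 - p) ^ ((n choose 2) - K) * (\<Prod>i\<in>UNIV. if i = C0 then 1 else (1 - (1 - p) ^ k (nxt i)) ^ k i)"
    unfolding n_def k_def K_def by (rule prob_tight_event(1)[OF V p])
  have K: "K \<le> n choose 2" unfolding n_def k_def K_def by (rule prob_tight_event(2)[OF V p])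
  have rhs: "(\<Prod>v\<in>V. real (card (col_class V h (h v))) / real (card V)) = (\<Prod>i\<in>UNIV. a i ^ k i)"
    using prod_col_class[OF V, of a h] by (simp add: a_def k_def n_def)
  show ?thesis
  \<comment> \<open>A nonempty class other than \<open>C0\<close> with empty successor class makes
    the probability zero. Otherwise the positivity hypothesis of \<open>exponent_le\<close>
    holds.\<close>
  proof (cases "\<exists>i. i \<noteq> C0 \<and> 0 < k i \<and> k (nxt i) = 0")
    case True
    then obtain i where "i \<noteq> C0" "0 < k i" "k (nxt i) = 0" by blast
    then have "(\<Prod>i\<in>UNIV. if i = C0 then 1 else (1 - (1 - p) ^ k (nxt i)) ^ k i) = 0"
      by (intro prod_zero bexI[of _ i]) (simp_all add: power_0_left)
    then have "measure_pmf.prob (Pi_pmf (vertex_pairs V) False (\<lambda>_. bernoulli_pmf p)) (tight_event V h) = 0"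
      unfolding prob by simp
    then show ?thesis unfolding p_def n_def by (simp add: prod_nonneg)
  next
    case False
    then have pos: "i \<noteq> C0 \<Longrightarrow> 0 < a i \<Longrightarrow> 0 < a (nxt i)" for i
      using n by (auto simp: a_def)
    define \<gamma> where "\<gamma> = (4 + 1 / 100000 :: real)"
    define c where "c i = (if i = C0 then 0 else a i * ln (1 - exp (- (\<gamma> * a (nxt i)))))" for i
    have expo: "(\<Sum>i\<in>UNIV. 4 * a i * a (nxt i) - a i * ln (a i) + c i) \<le> 2 - 1 / 1000"
      unfolding c_def \<gamma>_def using min
      by (intro exponent_le a0 sum1 pos) (auto simp: a_def k_def divide_right_mono)
    have "(1 - p) ^ ((n choose 2) - K) \<le> exp (- p) ^ ((n choose 2) - K)"
      using p exp_ge_add_one_self[of "- p"] by (intro power_mono) auto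
    also have "\<dots> = exp (- p * (real (n choose 2) - real K))"
      using K by (simp add: exp_of_nat_mult[symmetric] of_nat_diff mult.commute)
    \<comment> \<open>The product of 4 / n and n (n - 1) / 2 is 2 n - 2, whence the factor exp
      2.\<close>
    also have "- p * (real (n choose 2) - real K) = 2 - real n * (2 - (\<Sum>i\<in>UNIV. 4 * a i * a (nxt i)))"
    proof -
      have "real (n choose 2) = real n * (real n - 1) / 2"
      proof -
        have "2 * (n choose 2) = n * (n - 1)"
          unfolding choose_two using n(1) by (intro dvd_mult_div_cancel) auto
        then have "2 * real (n choose 2) = real n * real (n - 1)"
          by (metis of_nat_mult of_nat_numeral)
        then show ?thesis using n(1) by (simp add: of_nat_diff)
      qed
      moreover have "real K = (real n)\<^sup>2 / 4 * (\<Sum>i\<in>UNIV. 4 * a i * a (nxt i))"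
        by (simp add: K_def ka sum_distrib_left power2_eq_square mult_ac)
      ultimately show ?thesis using n by (simp add: p_def power2_eq_square field_simps)
    qed
    finally have nonedges: "(1 - p) ^ ((n choose 2) - K)
      \<le> exp (2 - real n * (2 - (\<Sum>i\<in>UNIV. 4 * a i * a (nxt i))))" .
    \<comment> \<open>An upper bound for 1 - (1 - p)^k needs a lower bound for 1 - p; this is why
      \<open>\<gamma>\<close> lies slightly above 4.\<close>
    have cover: "(if i = C0 then 1 else (1 - (1 - p) ^ k (nxt i)) ^ k i) \<le> exp (real n * c i)" for i
    proof (cases "i = C0 \<or> k i = 0")
      case True
      then show ?thesis by (auto simp: c_def a_def)
    next
      case False
      then have ai: "0 < a i" using n by (simp add: a_def)
      then have a': "0 < \<gamma> * a (nxt i)" using pos[of i] False by (simp add: \<gamma>_def)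
      have "exp (- (\<gamma> * a (nxt i))) = exp (- (\<gamma> / real n)) ^ k (nxt i)"
        by (simp add: exp_of_nat_mult[symmetric] a_def)
      also have "\<dots> \<le> (1 - p) ^ k (nxt i)"
        using one_minus_four_div_ge_exp[OF n(1)] unfolding \<gamma>_def p_def by (intro power_mono) auto
      finally have "(1 - (1 - p) ^ k (nxt i)) ^ k i \<le> (1 - exp (- (\<gamma> * a (nxt i)))) ^ k i"
        using p by (intro power_mono) (auto simp: power_le_one)
      also have "\<dots> = exp (ln (1 - exp (- (\<gamma> * a (nxt i))))) ^ k i"
        using a' by simp
      also have "\<dots> = exp (real n * c i)"
        using False by (simp add: exp_of_nat_mult[symmetric] c_def ka mult.assoc)
      finally show ?thesis using False by simp
    qed
    have "(\<Prod>i\<in>UNIV. if i = C0 then 1 else (1 - (1 - p) ^ k (nxt i)) ^ k i) \<le> (\<Prod>i\<in>UNIV. exp (real n * c i))"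
      using p by (intro prod_mono conjI cover) (auto simp: power_le_one)
    also have "\<dots> = exp (real n * (\<Sum>i\<in>UNIV. c i))"
      by (simp add: exp_sum sum_distrib_left)
    finally have "(1 - p) ^ ((n choose 2) - K) * (\<Prod>i\<in>UNIV. if i = C0 then 1 else (1 - (1 - p) ^ k (nxt i)) ^ k i)
      \<le> exp (2 - real n * (2 - (\<Sum>i\<in>UNIV. 4 * a i * a (nxt i)))) * exp (real n * (\<Sum>i\<in>UNIV. c i))"
      using p nonedges by (intro mult_mono prod_nonneg) (auto simp: power_le_one)
    also have "\<dots> = exp (2 + real n * ((\<Sum>i\<in>UNIV. 4 * a i * a (nxt i)) + (\<Sum>i\<in>UNIV. c i) - 2))"
      by (simp add: exp_add[symmetric] algebra_simps)
    also have "\<dots> \<le> exp (2 + real n * ((\<Sum>i\<in>UNIV. a i * ln (a i)) - 1 / 1000))"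
    proof -
      have "(\<Sum>i\<in>UNIV. 4 * a i * a (nxt i)) + (\<Sum>i\<in>UNIV. c i) - 2 \<le> (\<Sum>i\<in>UNIV. a i * ln (a i)) - 1 / 1000"
        using expo by (simp add: sum.distrib sum_subtractf)
      then show ?thesis using n by (simp add: mult_left_mono)
    qed
    also have "\<dots> = exp (2 - real n / 1000) * exp (\<Sum>i\<in>UNIV. real n * (a i * ln (a i)))"
      by (simp add: exp_add[symmetric] algebra_simps sum_distrib_left)
    also have "exp (\<Sum>i\<in>UNIV. real n * (a i * ln (a i))) = (\<Prod>i\<in>UNIV. a i ^ k i)"
      unfolding exp_sum[OF finite]
    proof (intro prod.cong refl)
      fix i
      show "exp (real n * (a i * ln (a i))) = a i ^ k i"
      \<comment> \<open>For an empty class both sides are 1, by 0 * ln 0 = 0 and 0^0 = 1.\<close>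
      proof (cases "a i = 0")
        case True
        then show ?thesis using ka[of i] by simp
      next
        case False
        have "exp (real n * (a i * ln (a i))) = exp (ln (a i)) ^ k i"
          by (simp add: exp_of_nat_mult[symmetric] ka mult.assoc)
        then show ?thesis using False a0[of i] by simp
      qed
    qed
    finally show ?thesis unfolding prob[symmetric] rhs by (simp add: p_def n_def)
  qed
qed

text \<open>For a fixed size vector s of total n >= 1, the product weights sum over all
  \<open>h\<close> to (\<Sum> s_i / n)^n = 1. Each \<open>h\<close> is charged to its own size
  vector, and there are at most (n + 1)^5 such vectors.\<close>

lemma sum_prod_class_sizes_le:
  assumes V: "finite V"
  shows "(\<Sum>h\<in>V \<rightarrow>\<^sub>E UNIV. \<Prod>v\<in>V. real (card (col_class V h (h v))) / real (card V))
    \<le> (real (card V) + 1) ^ 5"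
proof -
  define S where "S = {s \<in> (UNIV :: colour set) \<rightarrow>\<^sub>E {..card V}. (\<Sum>i\<in>UNIV. s i) = card V}"
  let ?w = "\<lambda>s h. \<Prod>v\<in>V. real (s (h v)) / real (card V)"
  have finS: "finite S" unfolding S_def by (rule finite_subset[of _ "UNIV \<rightarrow>\<^sub>E {..card V}"]) (auto intro!: finite_PiE)
  have finH: "finite (V \<rightarrow>\<^sub>E (UNIV :: colour set))" using V by (intro finite_PiE) auto
  have "(\<Sum>h\<in>V \<rightarrow>\<^sub>E UNIV. ?w (\<lambda>i. card (col_class V h i)) h) \<le> (\<Sum>h\<in>V \<rightarrow>\<^sub>E UNIV. \<Sum>s\<in>S. ?w s h)"
  proof (intro sum_mono)
    fix h
    have "(\<lambda>i. card (col_class V h i)) \<in> S"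
      using V by (auto simp: S_def col_class_def intro: card_mono sum_card_col_class[unfolded col_class_def])
    then show "?w (\<lambda>i. card (col_class V h i)) h \<le> (\<Sum>s\<in>S. ?w s h)"
      using finS by (intro member_le_sum[of _ S "\<lambda>s. ?w s h"]) (auto intro: prod_nonneg)
  qed
  also have "\<dots> = (\<Sum>s\<in>S. \<Sum>h\<in>V \<rightarrow>\<^sub>E UNIV. ?w s h)" by (rule sum.swap)
  also have "\<dots> = (\<Sum>s\<in>S. \<Prod>v\<in>V. \<Sum>i\<in>UNIV. real (s i) / real (card V))"
    using V by (intro sum.cong refl prod_sum_PiE[symmetric]) auto
  also have "\<dots> \<le> (\<Sum>s\<in>S. 1)"
  proof (intro sum_mono)
    fix s assume "s \<in> S"
    then have "(\<Sum>i\<in>UNIV. real (s i)) = real (card V)"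
      by (simp add: S_def flip: of_nat_sum)
    \<comment> \<open>Equality would fail for empty \<open>V\<close>, where the quotients are
      0.\<close>
    then have "(\<Sum>i\<in>UNIV. real (s i) / real (card V)) \<le> 1"
      by (simp add: sum_divide_distrib[symmetric])
    then show "(\<Prod>v\<in>V. \<Sum>i\<in>UNIV. real (s i) / real (card V)) \<le> 1"
      by (intro prod_le_1) (auto intro: sum_nonneg)
  qed
  also have "\<dots> = real (card S)" by simp
  also have "card S \<le> card ((UNIV :: colour set) \<rightarrow>\<^sub>E {..card V})"
    unfolding S_def by (intro card_mono finite_PiE) auto
  also have "\<dots> = (card V + 1) ^ 5"
  proof -
    have "card (UNIV :: colour set) = 5" by (simp add: UNIV_colour)
    then show ?thesis by (simp add: card_PiE)
  qed
  finally show ?thesis by (simp add: add.commute)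
qed

lemma prob_hom_le:
  assumes n: "n \<ge> 2000000"
  shows "measure_pmf.prob (random_graph n (4 / real n)) {G. \<exists>f. graph_hom f G (cycle_graph 5)}
    \<le> exp (2 - real n / 1000) * (real n + 1) ^ 5"
proof -
  define V where "V = {1..n}"
  define M where "M = Pi_pmf (vertex_pairs V) False (\<lambda>_. bernoulli_pmf (4 / real n))"
  define H where "H = {h \<in> V \<rightarrow>\<^sub>E UNIV. \<forall>i. card (col_class V h C3) \<le> card (col_class V h i)}"
  have V: "finite V" "card V = n" by (auto simp: V_def)
  have finE: "finite (V \<rightarrow>\<^sub>E (UNIV :: colour set))" using V by (intro finite_PiE) auto
  then have finH: "finite H" by (simp add: H_def)
  have "measure_pmf.prob (random_graph n (4 / real n)) {G. \<exists>f. graph_hom f G (cycle_graph 5)}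
      = measure_pmf.prob M {x. \<exists>f. graph_hom f (V, {e \<in> vertex_pairs V. x e}) (cycle_graph 5)}"
    by (simp add: random_graph_def V_def M_def vimage_def)
  \<comment> \<open>Homomorphisms are functions on all of \<open>nat\<close>; extensional colourings
    of \<open>V\<close> make the union finite.\<close>
  also have "\<dots> \<le> measure_pmf.prob M (\<Union>h\<in>H. tight_event V h)"
  proof (intro measure_pmf.finite_measure_mono subsetI)
    fix x assume "x \<in> {x. \<exists>f. graph_hom f (V, {e \<in> vertex_pairs V. x e}) (cycle_graph 5)}"
    then obtain h0 where "proper V {e \<in> vertex_pairs V. x e} h0"
      using graph_hom_cycle_graph_5_imp_proper by blast
    then obtain h where h: "h \<in> H" "proper V {e \<in> vertex_pairs V. x e} h"
        "\<forall>v\<in>V. h v \<noteq> C0 \<longrightarrow> (\<exists>u\<in>V. {v, u} \<in> {e \<in> vertex_pairs V. x e} \<and> h u = nxt (h v))"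
      using exists_tight_colouring[of V "{e \<in> vertex_pairs V. x e}" h0] V by (auto simp: H_def)
    then have "x \<in> tight_event V h"
      by (auto simp: tight_event_def proper_def vertex_pairs_def)
    then show "x \<in> (\<Union>h\<in>H. tight_event V h)" using h(1) by blast
  qed simp
  also have "\<dots> \<le> (\<Sum>h\<in>H. measure_pmf.prob M (tight_event V h))"
    using finH by (intro measure_pmf.finite_measure_subadditive_finite) auto
  also have "\<dots> \<le> (\<Sum>h\<in>H. exp (2 - real n / 1000) * (\<Prod>v\<in>V. real (card (col_class V h (h v))) / real n))"
    using prob_tight_event_le[OF V(1)] n unfolding M_def V(2) by (intro sum_mono) (auto simp: H_def)
  \<comment> \<open>Minimality of class \<open>C3\<close> has done its work in the exponent;
    dropping it adds only nonnegative terms and leaves a full sum over functions.\<close>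
  also have "\<dots> \<le> (\<Sum>h\<in>V \<rightarrow>\<^sub>E UNIV. exp (2 - real n / 1000) * (\<Prod>v\<in>V. real (card (col_class V h (h v))) / real n))"
    using finE by (intro sum_mono2) (auto simp: H_def intro!: mult_nonneg_nonneg prod_nonneg)
  also have "\<dots> = exp (2 - real n / 1000) * (\<Sum>h\<in>V \<rightarrow>\<^sub>E UNIV. \<Prod>v\<in>V. real (card (col_class V h (h v))) / real n)"
    by (simp add: sum_distrib_left)
  also have "\<dots> \<le> exp (2 - real n / 1000) * (real n + 1) ^ 5"
    using sum_prod_class_sizes_le[OF V(1)] unfolding V(2) by (intro mult_left_mono) auto
  finally show ?thesis .
qed

theorem theorem4:
  shows "(\<lambda>n::nat. measure_pmf.prob (random_graph n (4 / real n))
            {G. \<not> (\<exists>f. graph_hom f G (cycle_graph 5))}) \<longlonglongrightarrow> 1"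
proof -
  let ?hom = "\<lambda>n. measure_pmf.prob (random_graph n (4 / real n)) {G. \<exists>f. graph_hom f G (cycle_graph 5)}"
  have "?hom \<longlonglongrightarrow> 0"
  proof (rule tendsto_sandwich[where f = "\<lambda>_. 0"])
    show "eventually (\<lambda>n. ?hom n \<le> exp (2 - real n / 1000) * (real n + 1) ^ 5) sequentially"
      using eventually_ge_at_top[of 2000000] by eventually_elim (rule prob_hom_le)
    show "(\<lambda>n. exp (2 - real n / 1000) * (real n + 1) ^ 5) \<longlonglongrightarrow> 0"
      by real_asymp
  qed (simp_all add: tendsto_const)
  then have "(\<lambda>n. 1 - ?hom n) \<longlonglongrightarrow> 1 - 0"
    by (intro tendsto_diff tendsto_const)
  moreover have "measure_pmf.prob (random_graph n (4 / real n)) {G. \<not> (\<exists>f. graph_hom f G (cycle_graph 5))}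
      = 1 - ?hom n" for n
    using measure_pmf.prob_compl[of "{G. \<exists>f. graph_hom f G (cycle_graph 5)}" "random_graph n (4 / real n)"]
    by (simp only: space_measure_pmf sets_measure_pmf UNIV_I Compl_eq_Diff_UNIV[symmetric] Collect_neg_eq)
  ultimately show ?thesis by simp
qed

end
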